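(* Let $(E,[\cdot,\cdot]_D,\rho,(\cdot,\cdot))$ be a Courant algebroid over a smooth manifold $M$. For $e_1,e_2\in\Gamma(E)$ and $f\in C^\infty(M)$ define, by formal exponentials, $$e_1\rhd e_2:=\exp(\mathrm{ad}(e_1))\,e_2,\qquad e_1\rhd f:=\exp(\rho(e_1))\,f,$$ where $\mathrm{ad}(e_1)e_2=[e_1,e_2]_D$. Then $E$ with these operations is a metric bundle rackoid, i.e. the following identities hold (as identities of formal power series, in the sense explained in the context) for all $e_1,e_2,e_3\in\Gamma(E)$ and $f\in C^\infty(M)$: $$e_1\rhd(e_2\rhd e_3)=(e_1\rhd e_2)\rhd(e_1\rhd e_3),$$ $$e_1\rhd(e_2\rhd f)=(e_1\rhd e_2)\rhd(e_1\rhd f),$$ $$e_1\rhd(fe_2)=(e_1\rhd f)\cdot(e_1\rhd e_2),$$ $$e_1\rhd(e_2,e_3)=\big(e_1\rhd e_2,\;e_1\rhd e_3\big).$$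
   Context: A Courant algebroid over a smooth manifold $M$ is a quadruple $(E,[\cdot,\cdot]_D,\rho,(\cdot,\cdot))$ where $E\to M$ is a smooth real vector bundle, $[\cdot,\cdot]_D$ is an $\mathbb{R}$-bilinear bracket on $\Gamma(E)$, $\rho:E\to TM$ is a bundle map (the anchor), and $(\cdot,\cdot)$ is a non-degenerate symmetric bilinear form on $E$ (a pseudo-Euclidean inner product), such that for all $e,e_1,e_2,e_3\in\Gamma(E)$, $f\in C^\infty(M)$: (1) $[e_1,[e_2,e_3]_D]_D=[[e_1,e_2]_D,e_3]_D+[e_2,[e_1,e_3]_D]_D$; (2) $\rho([e_1,e_2]_D)=[\rho(e_1),\rho(e_2)]_{TM}$, the Lie bracket of vector fields; (3) $[e_1,fe_2]_D=f[e_1,e_2]_D+(\rho(e_1)\cdot f)\,e_2$; (4) $[e,e]_D=\frac12\mathcal{D}(e,e)$, where $\mathcal{D}:C^\infty(M)\to\Gamma(E)$ is the generalized exterior derivative determined by $(\mathcal{D}f,e)=\rho(e)\cdot f$; (5) $\rho(e_1)\cdot(e_2,e_3)=([e_1,e_2]_D,e_3)+(e_2,[e_1,e_3]_D)$. A bundle rackoid is a vector bundle $E$ over $M$ with operations $\rhd:\Gamma(E)\times\Gamma(E)\to\Gamma(E)$ and $\rhd:\Gamma(E)\times C^\infty(M)\to C^\infty(M)$ satisfying the first three identities of the claim, where $\cdot$ is multiplication of sections by functions. It is a metric bundle rackoid if $E$ carries a pseudo-Euclidean inner product $(\cdot,\cdot)$ and the fourth identity also holds. Meaning of "formal": $\exp(A)=\sum_{n\ge0}\frac{1}{n!}A^n$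 is a formal series and no convergence is claimed. Concretely, let $t_1,t_2$ be commuting formal parameters, extend the bracket, the anchor action, the inner product and the products $t_i$-linearly and continuously to $\Gamma(E)[[t_1,t_2]]$ and $C^\infty(M)[[t_1,t_2]]$, and replace $e_1$ by $t_1e_1$ and $e_2$ by $t_2e_2$ wherever they act from the left as first argument of $\rhd$ (also when occurring inside such an argument). Thus the identities read, in order: $\exp(\mathrm{ad}(t_1e_1))\exp(\mathrm{ad}(t_2e_2))e_3=\exp\big(\mathrm{ad}(\exp(\mathrm{ad}(t_1e_1))\,t_2e_2)\big)\exp(\mathrm{ad}(t_1e_1))e_3$; $\exp(\rho(t_1e_1))\exp(\rho(t_2e_2))f=\exp\big(\rho(\exp(\mathrm{ad}(t_1e_1))\,t_2e_2)\big)\exp(\rho(t_1e_1))f$; $\exp(\mathrm{ad}(t_1e_1))(fe_2)=\big(\exp(\rho(t_1e_1))f\big)\big(\exp(\mathrm{ad}(t_1e_1))e_2\big)$; $\exp(\rho(t_1e_1))(e_2,e_3)=\big(\exp(\mathrm{ad}(t_1e_1))e_2,\exp(\mathrm{ad}(t_1e_1))e_3\big)$. *)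

theory Defs
  imports "HOL-Analysis.Analysis" "HOL-Library.Function_Algebras"
begin

instantiation "fun" :: (type, real_vector) real_vector
begin

definition scaleR_fun :: "real \<Rightarrow> ('a \<Rightarrow> 'b) \<Rightarrow> 'a \<Rightarrow> 'b"
  where "scaleR_fun c f = (\<lambda>x. c *\<^sub>R f x)"

instance
  by standard (simp_all add: scaleR_fun_def fun_eq_iff algebra_simps)

end

lemma scaleR_fun_apply [simp]: "(c *\<^sub>R f) x = c *\<^sub>R f x"
  by (simp add: scaleR_fun_def)


section \<open>Smooth functions on open subsets of Euclidean space\<close>

text \<open>
  The model of \<open>n\<close>-dimensional Euclidean space is the library's \<^const>\<open>Euclidean_space\<close>, whose points
  are the real sequences vanishing from index \<open>n\<close> on; the dimension is a number (possibly 0), not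
  a type.  The predicates below are meant for sets \<open>W\<close> that are open in \<open>Euclidean_space n\<close>.
\<close>

definition partial_deriv :: "nat \<Rightarrow> ((nat \<Rightarrow> real) \<Rightarrow> real) \<Rightarrow> (nat \<Rightarrow> real) \<Rightarrow> real"
  where "partial_deriv i f x = deriv (\<lambda>t. f (x(i := t))) (x i)"

fun C_k_on :: "nat \<Rightarrow> nat \<Rightarrow> (nat \<Rightarrow> real) set \<Rightarrow> ((nat \<Rightarrow> real) \<Rightarrow> real) \<Rightarrow> bool"
  where
    "C_k_on 0 n W f \<longleftrightarrow>
       continuous_map (subtopology (Euclidean_space n) W) euclideanreal f"
  | "C_k_on (Suc k) n W f \<longleftrightarrow>
       continuous_map (subtopology (Euclidean_space n) W) euclideanreal f \<and>
       (\<forall>i<n. (\<forall>x\<in>W. (\<lambda>t. f (x(i := t))) differentiable at (x i)) \<and>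
              C_k_on k n W (partial_deriv i f))"

definition C_infinity_on :: "nat \<Rightarrow> (nat \<Rightarrow> real) set \<Rightarrow> ((nat \<Rightarrow> real) \<Rightarrow> real) \<Rightarrow> bool"
  where "C_infinity_on n W f \<longleftrightarrow> (\<forall>k. C_k_on k n W f)"


section \<open>Smooth manifolds\<close>

text \<open>
  The underlying topological space is a type \<open>'m\<close>; the smooth structure is given by an atlas that
  need not be maximal.
\<close>

type_synonym 'm chart = "'m set \<times> ('m \<Rightarrow> nat \<Rightarrow> real)"

locale smooth_manifold =
  fixes n :: nat
    and \<A> :: "'m::{t2_space, second_countable_topology} chart set"
  assumes chart_domain: "(U, \<phi>) \<in> \<A> \<Longrightarrow> open U"
    and chart_image: "(U, \<phi>) \<in> \<A> \<Longrightarrow> openin (Euclidean_space n) (\<phi> ` U)"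
    and chart_homeo: "(U, \<phi>) \<in> \<A> \<Longrightarrow>
      homeomorphic_map (top_of_set U) (subtopology (Euclidean_space n) (\<phi> ` U)) \<phi>"
    and chart_cover: "\<exists>(U, \<phi>) \<in> \<A>. p \<in> U"
    and chart_compatible: "\<lbrakk>(U, \<phi>) \<in> \<A>; (V, \<psi>) \<in> \<A>; j < n\<rbrakk> \<Longrightarrow>
      C_infinity_on n (\<phi> ` (U \<inter> V)) (\<lambda>x. \<psi> (inv_into U \<phi> x) j)"

text \<open>Functions whose restriction to the open set \<open>U\<close> is smooth; their values off \<open>U\<close> are irrelevant.\<close>

definition smooth_funs ::
    "nat \<Rightarrow> 'm::topological_space chart set \<Rightarrow> 'm set \<Rightarrow> ('m \<Rightarrow> real) set"
  where "smooth_funs n \<A> U =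
    {f. \<forall>(V, \<phi>) \<in> \<A>. C_infinity_on n (\<phi> ` (U \<inter> V)) (\<lambda>x. f (inv_into V \<phi> x))}"

abbreviation C_infinity :: "nat \<Rightarrow> 'm::topological_space chart set \<Rightarrow> ('m \<Rightarrow> real) set"
  where "C_infinity n \<A> \<equiv> smooth_funs n \<A> UNIV"


section \<open>Smooth real vector bundles\<close>

text \<open>
  The fibres \<open>E p\<close> are subspaces of an ambient real vector space \<open>'e\<close> of arbitrary dimension that
  carries no topology and plays no further role (any family of vector spaces embeds fibrewise into
  its direct sum); the total space is the disjoint union of the fibres.  Its smooth
  structure is given by local trivialisations \<open>(U, r, \<Phi>)\<close>, where \<open>\<Phi> p\<close> is the linear isomorphism
  from \<open>E p\<close> onto \<open>r\<close>-dimensional space for \<open>p \<in> U\<close>.  The rank is thus locally constant.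
\<close>

type_synonym ('m, 'e) triv = "'m set \<times> nat \<times> ('m \<Rightarrow> 'e \<Rightarrow> nat \<Rightarrow> real)"

definition linear_on_subspace ::
    "'a::real_vector set \<Rightarrow> ('a \<Rightarrow> 'b::real_vector) \<Rightarrow> bool"
  where "linear_on_subspace S L \<longleftrightarrow>
    (\<forall>u\<in>S. \<forall>v\<in>S. L (u + v) = L u + L v) \<and> (\<forall>c. \<forall>u\<in>S. L (c *\<^sub>R u) = c *\<^sub>R L u)"

text \<open>The \<open>a\<close>-th vector at \<open>p\<close> of the local frame belonging to a trivialisation.\<close>

definition frame ::
    "('m \<Rightarrow> 'e set) \<Rightarrow> ('m \<Rightarrow> 'e \<Rightarrow> nat \<Rightarrow> real) \<Rightarrow> nat \<Rightarrow> 'm \<Rightarrow> 'e"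
  where "frame E \<Phi> a p = inv_into (E p) (\<Phi> p) (\<lambda>i. if i = a then 1 else 0)"

locale smooth_vector_bundle = smooth_manifold n \<A>
  for n :: nat and \<A> :: "'m::{t2_space, second_countable_topology} chart set" +
  fixes E :: "'m \<Rightarrow> 'e::real_vector set"
    and \<T> :: "('m, 'e) triv set"
  assumes fibre_subspace: "subspace (E p)"
    and triv_domain: "(U, r, \<Phi>) \<in> \<T> \<Longrightarrow> open U"
    and triv_linear: "\<lbrakk>(U, r, \<Phi>) \<in> \<T>; p \<in> U\<rbrakk> \<Longrightarrow> linear_on_subspace (E p) (\<Phi> p)"
    and triv_bij: "\<lbrakk>(U, r, \<Phi>) \<in> \<T>; p \<in> U\<rbrakk> \<Longrightarrow>
      bij_betw (\<Phi> p) (E p) (topspace (Euclidean_space r))"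
    and triv_cover: "\<exists>(U, r, \<Phi>) \<in> \<T>. p \<in> U"
    and triv_compatible: "\<lbrakk>(U, r, \<Phi>) \<in> \<T>; (V, s, \<Psi>) \<in> \<T>; a < r; b < s\<rbrakk> \<Longrightarrow>
      (\<lambda>p. \<Psi> p (frame E \<Phi> a p) b) \<in> smooth_funs n \<A> (U \<inter> V)"

definition smooth_sections ::
    "nat \<Rightarrow> 'm::topological_space chart set \<Rightarrow> ('m \<Rightarrow> 'e set) \<Rightarrow> ('m, 'e) triv set \<Rightarrow>
     ('m \<Rightarrow> 'e) set"
  where "smooth_sections n \<A> E \<T> =
    {s. (\<forall>p. s p \<in> E p) \<and>
        (\<forall>(U, r, \<Phi>) \<in> \<T>. \<forall>i<r. (\<lambda>p. \<Phi> p (s p) i) \<in> smooth_funs n \<A> U)}"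

text \<open>Smooth bundle maps over the identity; smoothness is that of the local matrix entries.\<close>

definition smooth_bundle_map ::
    "nat \<Rightarrow> 'm::topological_space chart set \<Rightarrow>
     ('m \<Rightarrow> 'e::real_vector set) \<Rightarrow> ('m, 'e) triv set \<Rightarrow>
     ('m \<Rightarrow> 'd::real_vector set) \<Rightarrow> ('m, 'd) triv set \<Rightarrow> ('m \<Rightarrow> 'e \<Rightarrow> 'd) \<Rightarrow> bool"
  where "smooth_bundle_map n \<A> E \<T> F \<S> L \<longleftrightarrow>
    (\<forall>p. linear_on_subspace (E p) (L p) \<and> L p ` E p \<subseteq> F p) \<and>
    (\<forall>(U, r, \<Phi>) \<in> \<T>. \<forall>(V, s, \<Psi>) \<in> \<S>. \<forall>a<r. \<forall>b<s.
       (\<lambda>p. \<Psi> p (L p (frame E \<Phi> a p)) b) \<in> smooth_funs n \<A> (U \<inter> V))"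

definition pseudo_euclidean_metric ::
    "nat \<Rightarrow> 'm::topological_space chart set \<Rightarrow>
     ('m \<Rightarrow> 'e::real_vector set) \<Rightarrow> ('m, 'e) triv set \<Rightarrow> ('m \<Rightarrow> 'e \<Rightarrow> 'e \<Rightarrow> real) \<Rightarrow> bool"
  where "pseudo_euclidean_metric n \<A> E \<T> g \<longleftrightarrow>
    (\<forall>p. \<forall>u\<in>E p. linear_on_subspace (E p) (g p u)) \<and>
    (\<forall>p. \<forall>u\<in>E p. \<forall>v\<in>E p. g p u v = g p v u) \<and>
    (\<forall>p. \<forall>u\<in>E p. (\<forall>v\<in>E p. g p u v = 0) \<longrightarrow> u = 0) \<and>
    (\<forall>(U, r, \<Phi>) \<in> \<T>. \<forall>a<r. \<forall>b<r.
       (\<lambda>p. g p (frame E \<Phi> a p) (frame E \<Phi> b p)) \<in> smooth_funs n \<A> U)"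

definition section_inner ::
    "('m \<Rightarrow> 'e \<Rightarrow> 'e \<Rightarrow> real) \<Rightarrow> ('m \<Rightarrow> 'e) \<Rightarrow> ('m \<Rightarrow> 'e) \<Rightarrow> 'm \<Rightarrow> real"
  where "section_inner g s t = (\<lambda>p. g p (s p) (t p))"

definition section_mult ::
    "('m \<Rightarrow> real) \<Rightarrow> ('m \<Rightarrow> 'e::real_vector) \<Rightarrow> 'm \<Rightarrow> 'e"
  where "section_mult f s = (\<lambda>p. f p *\<^sub>R s p)"


section \<open>The tangent bundle and vector fields\<close>

definition smooth_near ::
    "nat \<Rightarrow> 'm::topological_space chart set \<Rightarrow> 'm \<Rightarrow> ('m \<Rightarrow> real) set"
  where "smooth_near n \<A> p = {f. \<exists>U. open U \<and> p \<in> U \<and> f \<in> smooth_funs n \<A> U}"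

text \<open>
  Tangent vectors at \<open>p\<close> are the derivations of the algebra of germs of smooth functions at \<open>p\<close>.
  A germ is given by any function representing it; by convention a tangent vector takes the value 0
  on functions that are not smooth near \<open>p\<close>, so that equality of functions is equality of
  tangent vectors.
\<close>

definition tangent_space ::
    "nat \<Rightarrow> 'm::topological_space chart set \<Rightarrow> 'm \<Rightarrow> (('m \<Rightarrow> real) \<Rightarrow> real) set"
  where "tangent_space n \<A> p =
    {v. linear_on_subspace (smooth_near n \<A> p) v \<and>
        (\<forall>f\<in>smooth_near n \<A> p. \<forall>h\<in>smooth_near n \<A> p. v (f * h) = f p * v h + h p * v f) \<and>
        (\<forall>f\<in>smooth_near n \<A> p. \<forall>h\<in>smooth_near n \<A> p.
           (\<exists>U. open U \<and> p \<in> U \<and> (\<forall>q\<in>U. f q = h q)) \<longrightarrow> v f = v h) \<and>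
        (\<forall>f. f \<notin> smooth_near n \<A> p \<longrightarrow> v f = 0)}"

text \<open>A chart trivialises the tangent bundle by \<open>v \<mapsto> (v x\<^sub>0, \<dots>, v x\<^sub>n\<^sub>-\<^sub>1)\<close>, with \<open>x\<^sub>i\<close> its coordinates.\<close>

definition tangent_triv ::
    "nat \<Rightarrow> 'm chart set \<Rightarrow> ('m, ('m \<Rightarrow> real) \<Rightarrow> real) triv set"
  where "tangent_triv n \<A> =
    (\<lambda>(U, \<phi>). (U, n, \<lambda>p v i. if i < n then v (\<lambda>q. \<phi> q i) else 0)) ` \<A>"

definition vf_apply ::
    "('m \<Rightarrow> ('m \<Rightarrow> real) \<Rightarrow> real) \<Rightarrow> ('m \<Rightarrow> real) \<Rightarrow> 'm \<Rightarrow> real"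
  where "vf_apply X f = (\<lambda>p. X p f)"

definition lie_bracket ::
    "nat \<Rightarrow> 'm::topological_space chart set \<Rightarrow> ('m \<Rightarrow> ('m \<Rightarrow> real) \<Rightarrow> real) \<Rightarrow>
     ('m \<Rightarrow> ('m \<Rightarrow> real) \<Rightarrow> real) \<Rightarrow> 'm \<Rightarrow> ('m \<Rightarrow> real) \<Rightarrow> real"
  where "lie_bracket n \<A> X Y = (\<lambda>p f.
    if f \<in> smooth_near n \<A> p then X p (vf_apply Y f) - Y p (vf_apply X f) else 0)"


section \<open>Courant algebroids\<close>

definition anchor_field :: "('m \<Rightarrow> 'e \<Rightarrow> 'd) \<Rightarrow> ('m \<Rightarrow> 'e) \<Rightarrow> 'm \<Rightarrow> 'd"
  where "anchor_field \<rho> e = (\<lambda>p. \<rho> p (e p))"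

definition anchor_act ::
    "('m \<Rightarrow> 'e \<Rightarrow> ('m \<Rightarrow> real) \<Rightarrow> real) \<Rightarrow> ('m \<Rightarrow> 'e) \<Rightarrow> ('m \<Rightarrow> real) \<Rightarrow> 'm \<Rightarrow> real"
  where "anchor_act \<rho> e f = vf_apply (anchor_field \<rho> e) f"

definition generalized_deriv ::
    "nat \<Rightarrow> 'm::topological_space chart set \<Rightarrow> ('m \<Rightarrow> 'e set) \<Rightarrow> ('m, 'e) triv set \<Rightarrow>
     ('m \<Rightarrow> 'e \<Rightarrow> ('m \<Rightarrow> real) \<Rightarrow> real) \<Rightarrow> ('m \<Rightarrow> 'e \<Rightarrow> 'e \<Rightarrow> real) \<Rightarrow> ('m \<Rightarrow> real) \<Rightarrow> 'm \<Rightarrow> 'e"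
  where "generalized_deriv n \<A> E \<T> \<rho> g f =
    (THE d. d \<in> smooth_sections n \<A> E \<T> \<and>
       (\<forall>e \<in> smooth_sections n \<A> E \<T>. section_inner g d e = anchor_act \<rho> e f))"

locale courant_algebroid = smooth_vector_bundle n \<A> E \<T>
  for n :: nat and \<A> :: "'m::{t2_space, second_countable_topology} chart set"
    and E :: "'m \<Rightarrow> 'e::real_vector set" and \<T> :: "('m, 'e) triv set" +
  fixes br :: "('m \<Rightarrow> 'e) \<Rightarrow> ('m \<Rightarrow> 'e) \<Rightarrow> 'm \<Rightarrow> 'e"
    and \<rho> :: "'m \<Rightarrow> 'e \<Rightarrow> ('m \<Rightarrow> real) \<Rightarrow> real"
    and g :: "'m \<Rightarrow> 'e \<Rightarrow> 'e \<Rightarrow> real"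
  assumes anchor: "smooth_bundle_map n \<A> E \<T> (tangent_space n \<A>) (tangent_triv n \<A>) \<rho>"
    and metric: "pseudo_euclidean_metric n \<A> E \<T> g"
    and bracket_closed:
      "\<lbrakk>e1 \<in> smooth_sections n \<A> E \<T>; e2 \<in> smooth_sections n \<A> E \<T>\<rbrakk> \<Longrightarrow>
       br e1 e2 \<in> smooth_sections n \<A> E \<T>"
    and bracket_linear_left:
      "e2 \<in> smooth_sections n \<A> E \<T> \<Longrightarrow>
       linear_on_subspace (smooth_sections n \<A> E \<T>) (\<lambda>e1. br e1 e2)"
    and bracket_linear_right:
      "e1 \<in> smooth_sections n \<A> E \<T> \<Longrightarrow>
       linear_on_subspace (smooth_sections n \<A> E \<T>) (\<lambda>e2. br e1 e2)"
    and jacobi: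
      "\<lbrakk>e1 \<in> smooth_sections n \<A> E \<T>; e2 \<in> smooth_sections n \<A> E \<T>;
        e3 \<in> smooth_sections n \<A> E \<T>\<rbrakk> \<Longrightarrow>
       br e1 (br e2 e3) = br (br e1 e2) e3 + br e2 (br e1 e3)"
    and anchor_bracket:
      "\<lbrakk>e1 \<in> smooth_sections n \<A> E \<T>; e2 \<in> smooth_sections n \<A> E \<T>\<rbrakk> \<Longrightarrow>
       anchor_field \<rho> (br e1 e2) = lie_bracket n \<A> (anchor_field \<rho> e1) (anchor_field \<rho> e2)"
    and leibniz:
      "\<lbrakk>e1 \<in> smooth_sections n \<A> E \<T>; e2 \<in> smooth_sections n \<A> E \<T>; f \<in> C_infinity n \<A>\<rbrakk> \<Longrightarrow>
       br e1 (section_mult f e2) =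
         section_mult f (br e1 e2) + section_mult (anchor_act \<rho> e1 f) e2"
    and bracket_diagonal:
      "e \<in> smooth_sections n \<A> E \<T> \<Longrightarrow>
       br e e = (1/2) *\<^sub>R generalized_deriv n \<A> E \<T> \<rho> g (section_inner g e e)"
    and metric_invariant:
      "\<lbrakk>e1 \<in> smooth_sections n \<A> E \<T>; e2 \<in> smooth_sections n \<A> E \<T>;
        e3 \<in> smooth_sections n \<A> E \<T>\<rbrakk> \<Longrightarrow>
       anchor_act \<rho> e1 (section_inner g e2 e3) =
         section_inner g (br e1 e2) e3 + section_inner g e2 (br e1 e3)"


section \<open>Formal power series in two commuting parameters\<close>

text \<open>\<open>X i j\<close> is the coefficient of \<open>t\<^sub>1\<^sup>i t\<^sub>2\<^sup>j\<close>.\<close>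

type_synonym 'a series2 = "nat \<Rightarrow> nat \<Rightarrow> 'a"

definition monomial2 :: "nat \<Rightarrow> nat \<Rightarrow> 'a::zero \<Rightarrow> 'a series2"
  where "monomial2 a b c = (\<lambda>i j. if i = a \<and> j = b then c else 0)"

abbreviation const2 :: "'a::zero \<Rightarrow> 'a series2"
  where "const2 \<equiv> monomial2 0 0"

abbreviation times_t1 :: "'a::zero \<Rightarrow> 'a series2"
  where "times_t1 \<equiv> monomial2 1 0"

abbreviation times_t2 :: "'a::zero \<Rightarrow> 'a series2"
  where "times_t2 \<equiv> monomial2 0 1"

definition series2_over :: "'a set \<Rightarrow> 'a series2 set"
  where "series2_over S = {X. \<forall>i j. X i j \<in> S}"

text \<open>The \<open>t\<^sub>1, t\<^sub>2\<close>-bilinear continuous extension of a bilinear operation on coefficients.\<close>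

definition extend2 ::
    "('a \<Rightarrow> 'b \<Rightarrow> 'c::comm_monoid_add) \<Rightarrow> 'a series2 \<Rightarrow> 'b series2 \<Rightarrow> 'c series2"
  where "extend2 B X Y = (\<lambda>i j. \<Sum>k\<le>i. \<Sum>l\<le>j. B (X k l) (Y (i - k) (j - l)))"

text \<open>
  \<open>formal_exp A Y\<close> is \<open>\<Sum>\<^sub>n A\<^sup>n Y / n!\<close>, summed coefficientwise over the nonzero terms.  It is used
  only for operators \<open>A\<close> that raise the total degree in \<open>t\<^sub>1, t\<^sub>2\<close>, and then only finitely many terms
  contribute to each coefficient.
\<close>

definition formal_exp ::
    "('a::real_vector series2 \<Rightarrow> 'a series2) \<Rightarrow> 'a series2 \<Rightarrow> 'a series2"
  where "formal_exp A Y =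
    (\<lambda>i j. \<Sum>n | (A ^^ n) Y i j \<noteq> 0. (1 / fact n) *\<^sub>R (A ^^ n) Y i j)"


section \<open>Formal metric bundle rackoids\<close>

text \<open>
  \<open>rs\<close> and \<open>rf\<close> are the operations on (series of) sections and functions.  Only series without
  constant term act from the left, which is where formal exponentials make sense.
\<close>

definition formal_bundle_rackoid ::
    "nat \<Rightarrow> 'm::{t2_space, second_countable_topology} chart set \<Rightarrow>
     ('m \<Rightarrow> 'e::real_vector set) \<Rightarrow> ('m, 'e) triv set \<Rightarrow>
     (('m \<Rightarrow> 'e) series2 \<Rightarrow> ('m \<Rightarrow> 'e) series2 \<Rightarrow> ('m \<Rightarrow> 'e) series2) \<Rightarrow>
     (('m \<Rightarrow> 'e) series2 \<Rightarrow> ('m \<Rightarrow> real) series2 \<Rightarrow> ('m \<Rightarrow> real) series2) \<Rightarrow> bool"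
  where "formal_bundle_rackoid n \<A> E \<T> rs rf \<longleftrightarrow>
    smooth_vector_bundle n \<A> E \<T> \<and>
    (\<forall>X \<in> series2_over (smooth_sections n \<A> E \<T>). X 0 0 = 0 \<longrightarrow>
       (\<forall>Y \<in> series2_over (smooth_sections n \<A> E \<T>).
          rs X Y \<in> series2_over (smooth_sections n \<A> E \<T>)) \<and>
       (\<forall>F \<in> series2_over (C_infinity n \<A>). rf X F \<in> series2_over (C_infinity n \<A>))) \<and>
    (\<forall>e1 \<in> smooth_sections n \<A> E \<T>. \<forall>e2 \<in> smooth_sections n \<A> E \<T>.
     \<forall>e3 \<in> smooth_sections n \<A> E \<T>.
       rs (times_t1 e1) (rs (times_t2 e2) (const2 e3)) =
       rs (rs (times_t1 e1) (times_t2 e2)) (rs (times_t1 e1) (const2 e3))) \<and>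
    (\<forall>e1 \<in> smooth_sections n \<A> E \<T>. \<forall>e2 \<in> smooth_sections n \<A> E \<T>. \<forall>f \<in> C_infinity n \<A>.
       rf (times_t1 e1) (rf (times_t2 e2) (const2 f)) =
       rf (rs (times_t1 e1) (times_t2 e2)) (rf (times_t1 e1) (const2 f))) \<and>
    (\<forall>e1 \<in> smooth_sections n \<A> E \<T>. \<forall>e2 \<in> smooth_sections n \<A> E \<T>. \<forall>f \<in> C_infinity n \<A>.
       rs (times_t1 e1) (const2 (section_mult f e2)) =
       extend2 section_mult (rf (times_t1 e1) (const2 f)) (rs (times_t1 e1) (const2 e2)))"

definition formal_metric_bundle_rackoid ::
    "nat \<Rightarrow> 'm::{t2_space, second_countable_topology} chart set \<Rightarrow>
     ('m \<Rightarrow> 'e::real_vector set) \<Rightarrow> ('m, 'e) triv set \<Rightarrow> ('m \<Rightarrow> 'e \<Rightarrow> 'e \<Rightarrow> real) \<Rightarrow>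
     (('m \<Rightarrow> 'e) series2 \<Rightarrow> ('m \<Rightarrow> 'e) series2 \<Rightarrow> ('m \<Rightarrow> 'e) series2) \<Rightarrow>
     (('m \<Rightarrow> 'e) series2 \<Rightarrow> ('m \<Rightarrow> real) series2 \<Rightarrow> ('m \<Rightarrow> real) series2) \<Rightarrow> bool"
  where "formal_metric_bundle_rackoid n \<A> E \<T> g rs rf \<longleftrightarrow>
    formal_bundle_rackoid n \<A> E \<T> rs rf \<and>
    pseudo_euclidean_metric n \<A> E \<T> g \<and>
    (\<forall>e1 \<in> smooth_sections n \<A> E \<T>. \<forall>e2 \<in> smooth_sections n \<A> E \<T>.
     \<forall>e3 \<in> smooth_sections n \<A> E \<T>.
       rf (times_t1 e1) (const2 (section_inner g e2 e3)) =
       extend2 (section_inner g) (rs (times_t1 e1) (const2 e2)) (rs (times_t1 e1) (const2 e3)))"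

definition exp_ad ::
    "(('m \<Rightarrow> 'e) \<Rightarrow> ('m \<Rightarrow> 'e) \<Rightarrow> 'm \<Rightarrow> 'e) \<Rightarrow>
     ('m \<Rightarrow> 'e) series2 \<Rightarrow> ('m \<Rightarrow> 'e) series2 \<Rightarrow> ('m \<Rightarrow> 'e::real_vector) series2"
  where "exp_ad br X Y = formal_exp (extend2 br X) Y"

definition exp_anchor ::
    "('m \<Rightarrow> 'e \<Rightarrow> ('m \<Rightarrow> real) \<Rightarrow> real) \<Rightarrow>
     ('m \<Rightarrow> 'e) series2 \<Rightarrow> ('m \<Rightarrow> real) series2 \<Rightarrow> ('m \<Rightarrow> real) series2"
  where "exp_anchor \<rho> X F = formal_exp (extend2 (anchor_act \<rho>) X) F"

end

theory Submission
  imports Defs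
begin

text \<open>
  Apart from smoothness of \<open>\<rho>(e) \<cdot> f\<close>, everything is algebra.  Put \<open>a\<^sub>i = a\<^sup>i / i!\<close>.  The Leibniz rule
  says \<open>c\<^sub>i (b x y) = (\<Sum>k\<le>i. b (a\<^sub>k x) (a'\<^sub>i\<^sub>-\<^sub>k y))\<close> whenever the operator \<open>c\<close> is a derivation of the
  bilinear \<open>b\<close> along \<open>a\<close> and \<open>a'\<close>; the derivations at hand are \<open>ad(e)\<close> and \<open>\<rho>(e)\<close>.  This is the
  compatibility of \<open>exp(t\<^sub>1 c)\<close> with products.  In the self-distributivity identities it gives
  \<open>(ad(exp(ad(t\<^sub>1 e\<^sub>1)) t\<^sub>2 e\<^sub>2))\<^sup>m exp(ad(t\<^sub>1 e\<^sub>1)) e\<^sub>3 = t\<^sub>2\<^sup>m exp(ad(t\<^sub>1 e\<^sub>1)) ad(e\<^sub>2)\<^sup>m e\<^sub>3\<close>, to be summed over \<open>m\<close>.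

  Smoothness of \<open>\<rho>(e) \<cdot> f\<close> needs the coordinate expression of a derivation of germs, hence Hadamard's
  lemma \<open>F x = F a + (\<Sum>i<n. (x\<^sub>i - a\<^sub>i) H\<^sub>i x)\<close> with smooth \<open>H\<^sub>i\<close>.  Moving one coordinate at a time to \<open>a\<close>
  makes it a consequence of one-dimensional integration, and its case of \<open>C\<^sup>1\<close> functions \<open>F\<close> and
  continuous \<open>H\<^sub>i\<close> yields the chain rule.
\<close>


section \<open>Calculus on open subsets of Euclidean space\<close>

text \<open>\<open>Euclidean_space n\<close> is a subspace of a product of lines, whose product
  topology is the type-class topology on functions. This turns abstract openness and continuity into
  \<open>open\<close> and \<open>continuous_on\<close>.\<close>

lemma Euclidean_space_top_of_set: "Euclidean_space n = top_of_set (topspace (Euclidean_space n))"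
  by (simp add: Euclidean_space_def euclidean_product_topology)

lemma openin_Euclidean_space:
  "openin (Euclidean_space n) W \<longleftrightarrow> (\<exists>T. open T \<and> W = T \<inter> topspace (Euclidean_space n))"
  by (subst Euclidean_space_top_of_set) (auto simp: openin_open)

lemma continuous_map_Euclidean_space_subtopology:
  assumes "W \<subseteq> topspace (Euclidean_space n)"
  shows "continuous_map (subtopology (Euclidean_space n) W) euclideanreal f \<longleftrightarrow> continuous_on W f"
  using assms
  by (subst Euclidean_space_top_of_set) (simp add: subtopology_subtopology Int_absorb1)

text \<open>The ball of the maximum norm. Its shape makes it evident that moving single coordinates
  towards those of \<open>a\<close> does not leave it, as Hadamard's lemma requires.\<close>

definition coord_box :: "nat \<Rightarrow> (nat \<Rightarrow> real) \<Rightarrow> real \<Rightarrow> (nat \<Rightarrow> real) set"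
  where "coord_box n a \<epsilon> = {x \<in> topspace (Euclidean_space n). \<forall>i<n. \<bar>x i - a i\<bar> < \<epsilon>}"

lemma openin_coord_box: "openin (Euclidean_space n) (coord_box n a \<epsilon>)"
proof -
  have "open {x::nat \<Rightarrow> real. \<bar>x i - a i\<bar> < \<epsilon>}" for i
    by (intro open_Collect_less continuous_intros continuous_on_product_coordinates)
  then have "open (\<Inter>i\<in>{..<n}. {x. \<bar>x i - a i\<bar> < \<epsilon>})"
    by blast
  moreover have "coord_box n a \<epsilon>
      = (\<Inter>i\<in>{..<n}. {x. \<bar>x i - a i\<bar> < \<epsilon>}) \<inter> topspace (Euclidean_space n)"
    by (auto simp: coord_box_def)
  ultimately show ?thesis
    unfolding openin_Euclidean_space by blast
qed

lemma coord_box_center: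
  "\<lbrakk>a \<in> topspace (Euclidean_space n); 0 < \<epsilon>\<rbrakk> \<Longrightarrow> a \<in> coord_box n a \<epsilon>"
  by (simp add: coord_box_def)

lemma coord_box_within_open:
  assumes W: "openin (Euclidean_space n) W" and a: "a \<in> W"
  obtains \<epsilon> where "0 < \<epsilon>" "coord_box n a \<epsilon> \<subseteq> W"
proof -
  obtain T where T: "open T" "W = T \<inter> topspace (Euclidean_space n)"
    using W openin_Euclidean_space by blast
  have "openin (product_topology (\<lambda>i. euclidean) UNIV) T"
    using T by (simp add: open_fun_def)
  then obtain X where X: "a \<in> (\<Pi>\<^sub>E i\<in>UNIV. X i)" "\<And>i. open (X i)" "(\<Pi>\<^sub>E i\<in>UNIV. X i) \<subseteq> T"
    using product_topology_open_contains_basis[of "\<lambda>i. euclidean" UNIV T a] T a by auto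
  have "\<exists>e>0. ball (a i) e \<subseteq> X i" for i
    using X open_contains_ball by blast
  then obtain e where e: "\<And>i. 0 < e i" "\<And>i. ball (a i) (e i) \<subseteq> X i"
    by metis
  \<comment> \<open>Only the first \<open>n\<close> coordinates need a common radius; the inserted 1
    makes the set nonempty if \<open>n = 0\<close>.\<close>
  define \<epsilon> where "\<epsilon> = Min (insert 1 (e ` {..<n}))"
  have "0 < \<epsilon>"
    using e by (simp add: \<epsilon>_def)
  moreover have "coord_box n a \<epsilon> \<subseteq> W"
  proof
    fix x assume x: "x \<in> coord_box n a \<epsilon>"
    have "x i \<in> X i" for i
    proof (cases "i < n")
      case True
      then have "\<epsilon> \<le> e i"
        by (auto simp: \<epsilon>_def)
      then have "x i \<in> ball (a i) (e i)"
        using x True by (auto simp: coord_box_def dist_real_def abs_minus_commute)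
      then show ?thesis using e by blast
    next
      case False
      \<comment> \<open>Both points vanish from index \<open>n\<close> on.\<close>
      then have "x i = a i"
        using x a T by (auto simp: coord_box_def topspace_Euclidean_space)
      then show ?thesis using X by auto
    qed
    then have "x \<in> T" using X by blast
    then show "x \<in> W" using x T by (simp add: coord_box_def)
  qed
  ultimately show ?thesis by (rule that)
qed

text \<open>Partial derivatives at a point of an open set see only values inside that set, because a
  short piece of each coordinate line stays in it.\<close>

lemma coord_line_in_open:
  assumes W: "openin (Euclidean_space n) W" and x: "x \<in> W" and i: "i < n"
  shows "\<exists>\<delta>>0. \<forall>t\<in>ball (x i) \<delta>. x(i := t) \<in> W"
proof -
  obtain \<epsilon> where e: "0 < \<epsilon>" "coord_box n x \<epsilon> \<subseteq> W"
    using coord_box_within_open[OF W x] .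
  have xt: "x \<in> topspace (Euclidean_space n)"
    using W x openin_subset by blast
  show ?thesis
  proof (intro exI conjI ballI)
    show "0 < \<epsilon>" by (rule e)
    fix t assume "t \<in> ball (x i) \<epsilon>"
    then have "x(i := t) \<in> coord_box n x \<epsilon>"
      using xt i e by (auto simp: coord_box_def topspace_Euclidean_space dist_real_def abs_minus_commute)
    then show "x(i := t) \<in> W" using e by blast
  qed
qed

lemma continuous_on_coord_line: "continuous_on S (\<lambda>t. x(i := t :: real))"
proof (rule continuous_on_coordinatewise_then_product)
  show "continuous_on S (\<lambda>t. (x(i := t)) j)" for j
    by (cases "j = i") auto
qed

lemma continuous_on_coord: "continuous_on S (\<lambda>x. x i :: real)"
  by (rule continuous_on_subset[OF continuous_on_product_coordinates]) simp

section \<open>Functions of class \<open>C_k_on\<close> and their closure properties\<close>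

lemma C_k_on_imp_continuous_on:
  assumes "C_k_on k n W f" "openin (Euclidean_space n) W"
  shows "continuous_on W f"
  using assms openin_subset[OF assms(2)]
  by (cases k) (auto simp: continuous_map_Euclidean_space_subtopology)

lemma C_k_on_has_partial:
  assumes "C_k_on (Suc k) n W f" "x \<in> W" "i < n"
  shows "((\<lambda>t. f (x(i := t))) has_real_derivative partial_deriv i f x) (at (x i))"
  using assms by (simp add: partial_deriv_def DERIV_deriv_iff_real_differentiable)

text \<open>Although \<open>partial_deriv\<close> is formed from total functions, its value at a
  point of \<open>W\<close> is determined on a short coordinate interval inside \<open>W\<close>. So
  equality on \<open>W\<close> passes to all iterated partial derivatives.\<close>

lemma C_k_on_cong:
  assumes W: "openin (Euclidean_space n) W"
  shows "\<lbrakk>\<And>x. x \<in> W \<Longrightarrow> f x = h x; C_k_on k n W f\<rbrakk> \<Longrightarrow> C_k_on k n W h"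
proof (induction k arbitrary: f h)
  case 0
  then show ?case
    using openin_subset[OF W]
    by (auto simp: continuous_map_Euclidean_space_subtopology cong: continuous_on_cong)
next
  case (Suc k)
  have D: "((\<lambda>t. h (x(i := t))) has_real_derivative partial_deriv i f x) (at (x i))"
    if x: "x \<in> W" and i: "i < n" for x i
  proof -
    obtain \<delta> where d: "0 < \<delta>" "\<forall>t\<in>ball (x i) \<delta>. x(i := t) \<in> W"
      using coord_line_in_open[OF W x i] by blast
    have "((\<lambda>t. f (x(i := t))) has_real_derivative partial_deriv i f x) (at (x i))"
      by (rule C_k_on_has_partial[OF Suc.prems(2) x i])
    then show ?thesis
      by (rule has_field_derivative_transform_within_open[where S = "ball (x i) \<delta>"])
        (use d in \<open>auto intro: Suc.prems(1) simp del: mem_ball\<close>)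
  qed
  have "C_k_on k n W (partial_deriv i h)" if "i < n" for i
  proof (rule Suc.IH[of "partial_deriv i f"])
    show "partial_deriv i f x = partial_deriv i h x" if "x \<in> W" for x
      using DERIV_imp_deriv[OF D[OF that \<open>i < n\<close>]] by (simp add: partial_deriv_def[of i h])
    show "C_k_on k n W (partial_deriv i f)"
      using Suc.prems(2) that by simp
  qed
  moreover have "(\<lambda>t. h (x(i := t))) differentiable at (x i)" if "i < n" "x \<in> W" for x i
    using D[OF that(2,1)] real_differentiable_def by blast
  moreover have "continuous_on W h"
    using C_k_on_imp_continuous_on[OF Suc.prems(2) W] Suc.prems(1)
    by (auto cong: continuous_on_cong)
  ultimately show ?case
    using openin_subset[OF W] by (simp add: continuous_map_Euclidean_space_subtopology)
qed

text \<open>Admits candidate derivatives in closed form: derivatives are unique, so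
  \<open>D i\<close> and \<open>partial_deriv i f\<close> agree on \<open>W\<close>.\<close>

lemma C_k_on_SucI:
  assumes W: "openin (Euclidean_space n) W"
    and cont: "continuous_on W f"
    and der: "\<And>x i. \<lbrakk>x \<in> W; i < n\<rbrakk> \<Longrightarrow>
      ((\<lambda>t. f (x(i := t))) has_real_derivative D i x) (at (x i))"
    and D: "\<And>i. i < n \<Longrightarrow> C_k_on k n W (D i)"
  shows "C_k_on (Suc k) n W f"
proof -
  have "C_k_on k n W (partial_deriv i f)" if "i < n" for i
    by (rule C_k_on_cong[OF W _ D[OF that]])
      (simp only: partial_deriv_def DERIV_imp_deriv[OF der[OF _ that]])
  moreover have "(\<lambda>t. f (x(i := t))) differentiable at (x i)" if "i < n" "x \<in> W" for x i
    using der[OF that(2,1)] real_differentiable_def by blast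
  ultimately show ?thesis
    using cont openin_subset[OF W] by (simp add: continuous_map_Euclidean_space_subtopology)
qed

lemma C_k_on_Suc_imp:
  assumes "openin (Euclidean_space n) W"
  shows "C_k_on (Suc k) n W f \<Longrightarrow> C_k_on k n W f"
proof (induction k arbitrary: f)
  case (Suc k)
  from Suc.prems show ?case
    by (simp only: C_k_on.simps(2)[of "Suc k"])
      (use Suc.IH in \<open>auto simp del: C_k_on.simps simp: C_k_on.simps(2)[of k]\<close>)
qed simp

lemma C_k_on_subset:
  assumes V: "V \<subseteq> W"
  shows "C_k_on k n W f \<Longrightarrow> C_k_on k n V f"
proof (induction k arbitrary: f)
  case 0
  then show ?case
    using continuous_map_from_subtopology_mono[OF _ V] by auto
next
  case (Suc k)
  then show ?case
    using continuous_map_from_subtopology_mono[OF _ V] V by auto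
qed

lemma C_k_on_local:
  assumes W: "openin (Euclidean_space n) W"
  shows "(\<And>x. x \<in> W \<Longrightarrow> \<exists>V. openin (Euclidean_space n) V \<and> x \<in> V \<and> C_k_on k n V f) \<Longrightarrow>
    C_k_on k n W f"
proof (induction k arbitrary: f)
  case 0
  have "continuous_on W f"
    unfolding continuous_on_eq_continuous_within
  proof
    fix x assume "x \<in> W"
    then obtain V where V: "openin (Euclidean_space n) V" "x \<in> V" "C_k_on 0 n V f"
      using 0 by blast
    then have c: "continuous_on V f"
      using C_k_on_imp_continuous_on by blast
    obtain T where T: "open T" "V = T \<inter> topspace (Euclidean_space n)"
      using V openin_Euclidean_space by blast
    have "continuous (at x within V) f"
      using c V by (simp add: continuous_on_eq_continuous_within)
    then have "continuous (at x within (T \<inter> W)) f"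
      by (rule continuous_within_subset) (use T openin_subset[OF W] in auto)
    \<comment> \<open>\<open>T\<close> is an open neighbourhood of \<open>x\<close>, so intersecting
      with it does not change the filter.\<close>
    moreover have "at x within (T \<inter> W) = at x within W"
      by (rule at_within_nhd[of x T]) (use T V in auto)
    ultimately show "continuous (at x within W) f"
      by simp
  qed
  then show ?case
    using openin_subset[OF W] by (simp add: continuous_map_Euclidean_space_subtopology)
next
  case (Suc k)
  have "C_k_on k n W (partial_deriv i f)" if "i < n" for i
    using Suc.prems that by (intro Suc.IH) (meson C_k_on.simps(2))
  moreover have "(\<lambda>t. f (x(i := t))) differentiable at (x i)" if "i < n" "x \<in> W" for x i
  proof -
    obtain V where "x \<in> V" "C_k_on (Suc k) n V f"
      using Suc.prems[OF \<open>x \<in> W\<close>] by blast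
    from C_k_on_has_partial[OF this(2,1) \<open>i < n\<close>] show ?thesis
      using real_differentiable_def by blast
  qed
  \<comment> \<open>The induction hypothesis for \<open>f\<close> itself supplies its continuity on
    \<open>W\<close>.\<close>
  moreover have "C_k_on k n W f"
  proof (rule Suc.IH)
    fix x assume "x \<in> W"
    then obtain V where "openin (Euclidean_space n) V" "x \<in> V" "C_k_on (Suc k) n V f"
      using Suc.prems by blast
    then show "\<exists>V. openin (Euclidean_space n) V \<and> x \<in> V \<and> C_k_on k n V f"
      using C_k_on_Suc_imp by blast
  qed
  then have "continuous_on W f"
    using C_k_on_imp_continuous_on W by blast
  ultimately show ?case
    using openin_subset[OF W] by (simp add: continuous_map_Euclidean_space_subtopology)
qed

lemma C_k_on_const: "openin (Euclidean_space n) W \<Longrightarrow> C_k_on k n W (\<lambda>x. c)"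
proof (induction k arbitrary: c)
  case (Suc k)
  then show ?case
    by (intro C_k_on_SucI[where D = "\<lambda>i x. 0"]) auto
qed simp

lemma C_k_on_add:
  assumes W: "openin (Euclidean_space n) W"
  shows "\<lbrakk>C_k_on k n W f; C_k_on k n W h\<rbrakk> \<Longrightarrow> C_k_on k n W (\<lambda>x. f x + h x)"
proof (induction k arbitrary: f h)
  case 0
  then show ?case
    using openin_subset[OF W]
    by (auto simp: continuous_map_Euclidean_space_subtopology intro: continuous_intros)
next
  case (Suc k)
  show ?case
  proof (rule C_k_on_SucI[OF W, where D = "\<lambda>i x. partial_deriv i f x + partial_deriv i h x"])
    show "continuous_on W (\<lambda>x. f x + h x)"
      using Suc.prems W by (intro continuous_intros C_k_on_imp_continuous_on)
    show "((\<lambda>t. f (x(i := t)) + h (x(i := t))) has_real_derivative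
        partial_deriv i f x + partial_deriv i h x) (at (x i))" if "x \<in> W" "i < n" for x i
      using Suc.prems that by (intro derivative_intros C_k_on_has_partial)
    show "C_k_on k n W (\<lambda>x. partial_deriv i f x + partial_deriv i h x)" if "i < n" for i
      using Suc.prems that by (intro Suc.IH) auto
  qed
qed

lemma C_k_on_mult:
  assumes W: "openin (Euclidean_space n) W"
  shows "\<lbrakk>C_k_on k n W f; C_k_on k n W h\<rbrakk> \<Longrightarrow> C_k_on k n W (\<lambda>x. f x * h x)"
proof (induction k arbitrary: f h)
  case 0
  then show ?case
    using openin_subset[OF W]
    by (auto simp: continuous_map_Euclidean_space_subtopology intro: continuous_intros)
next
  case (Suc k)
  show ?case
  proof (rule C_k_on_SucI[OF W, where D = "\<lambda>i x. partial_deriv i f x * h x + f x * partial_deriv i h x"])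
    show "continuous_on W (\<lambda>x. f x * h x)"
      using Suc.prems W by (intro continuous_intros C_k_on_imp_continuous_on)
    show "((\<lambda>t. f (x(i := t)) * h (x(i := t))) has_real_derivative
        partial_deriv i f x * h x + f x * partial_deriv i h x) (at (x i))" if "x \<in> W" "i < n" for x i
      by (rule derivative_eq_intros C_k_on_has_partial[OF Suc.prems(1) that]
          C_k_on_has_partial[OF Suc.prems(2) that])+ (simp add: algebra_simps)
    show "C_k_on k n W (\<lambda>x. partial_deriv i f x * h x + f x * partial_deriv i h x)" if "i < n" for i
      using Suc.prems that W by (intro C_k_on_add Suc.IH)
        (auto intro: C_k_on_Suc_imp simp del: C_k_on.simps simp: C_k_on.simps(2)[of k])
  qed
qed

lemma C_k_on_sum:
  assumes "openin (Euclidean_space n) W"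
  shows "(\<And>a. a \<in> A \<Longrightarrow> C_k_on k n W (f a)) \<Longrightarrow> C_k_on k n W (\<lambda>x. \<Sum>a\<in>A. f a x)"
  by (induction A rule: infinite_finite_induct)
    (simp_all add: C_k_on_const C_k_on_add assms)

text \<open>Differentiation under the integral and the chain rule ask only for continuous first
  derivatives; this reaches that case from any class \<open>Suc k\<close>.\<close>

lemma C_k_on_Suc_imp_1:
  assumes W: "openin (Euclidean_space n) W" and f: "C_k_on (Suc k) n W f"
  shows "C_k_on (Suc 0) n W f"
proof -
  have "C_k_on 0 n W (partial_deriv i f)" if "i < n" for i
  proof -
    have "continuous_on W (partial_deriv i f)"
      by (rule C_k_on_imp_continuous_on[OF _ W, of k]) (use f that in simp)
    then show ?thesis
      using openin_subset[OF W] by (simp add: continuous_map_Euclidean_space_subtopology)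
  qed
  then show ?thesis
    using f by simp
qed

section \<open>Averages over coordinate segments\<close>

text \<open>
  The remainder factor in Hadamard's lemma is the case \<open>m = 0\<close>.  The weight \<open>t ^ m\<close> makes the family
  closed under partial differentiation: \<open>\<partial>\<^sub>k\<close> brings down another factor \<open>t\<close>.
\<close>

definition segment_avg ::
    "nat \<Rightarrow> real \<Rightarrow> nat \<Rightarrow> ((nat \<Rightarrow> real) \<Rightarrow> real) \<Rightarrow> (nat \<Rightarrow> real) \<Rightarrow> real"
  where "segment_avg k c m F x = integral {0..1} (\<lambda>t. t ^ m * F (x(k := c + t * (x k - c))))"

definition segment_closed :: "nat \<Rightarrow> real \<Rightarrow> (nat \<Rightarrow> real) set \<Rightarrow> bool"
  where "segment_closed k c W \<longleftrightarrow> (\<forall>x\<in>W. \<forall>t\<in>{0..1}. x(k := c + t * (x k - c)) \<in> W)"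

text \<open>The map \<open>u\<close> covers two uses: the identity of \<open>W\<close> gives
  continuity of the average in \<open>x\<close>, and a coordinate line gives the hypotheses for
  differentiating under the integral.\<close>

lemma continuous_on_segment_integrand:
  assumes F: "continuous_on W F" and W: "segment_closed k c W"
    and u: "continuous_on U u" "u ` U \<subseteq> W"
  shows "continuous_on (U \<times> cbox 0 (1::real))
    (\<lambda>(s, t). t ^ m * F ((u s)(k := c + t * (u s k - c))))"
proof -
  have us: "continuous_on (U \<times> cbox 0 (1::real)) (\<lambda>z. u (fst z) j)" for j
    by (rule continuous_on_product_then_coordinatewise[OF continuous_on_compose2[OF u(1)]])
      (auto intro: continuous_intros)
  have "continuous_on (U \<times> cbox 0 (1::real))
      (\<lambda>z. (u (fst z))(k := c + snd z * (u (fst z) k - c)))"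
  proof (rule continuous_on_coordinatewise_then_product)
    fix j
    have "continuous_on (U \<times> cbox 0 (1::real)) (\<lambda>z. c + snd z * (u (fst z) k - c))"
      by (intro continuous_intros us)
    then show "continuous_on (U \<times> cbox 0 (1::real))
        (\<lambda>z. ((u (fst z))(k := c + snd z * (u (fst z) k - c))) j)"
      using us[of j] by (cases "j = k") simp_all
  qed
  moreover have "(\<lambda>z. (u (fst z))(k := c + snd z * (u (fst z) k - c))) ` (U \<times> cbox 0 1) \<subseteq> W"
    using W u(2) by (force simp: segment_closed_def)
  ultimately have "continuous_on (U \<times> cbox 0 (1::real))
      (\<lambda>z. F ((u (fst z))(k := c + snd z * (u (fst z) k - c))))"
    by (rule continuous_on_compose2[OF F])
  then show ?thesis
    by (simp add: case_prod_unfold) (intro continuous_intros)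
qed

lemma continuous_on_segment_avg:
  assumes "continuous_on W F" and "segment_closed k c W"
  shows "continuous_on W (segment_avg k c m F)"
proof -
  have "continuous_on (W \<times> cbox 0 1) (\<lambda>(x, t). t ^ m * F (x(k := c + t * (x k - c))))"
    by (rule continuous_on_segment_integrand[OF assms]) auto
  from integral_continuous_on_param[OF this] show ?thesis
    by (simp add: segment_avg_def[abs_def])
qed

text \<open>Differentiation under the integral sign along the \<open>i\<close>-th coordinate line.
  For \<open>i = k\<close> the point on the segment moves with speed \<open>t\<close>, which
  accounts for the raised weight; otherwise it moves with speed 1.\<close>

lemma partial_segment_avg:
  assumes W: "openin (Euclidean_space n) W" "segment_closed k c W"
    and F: "C_k_on (Suc 0) n W F" and x: "x \<in> W" and i: "i < n"
  shows "((\<lambda>s. segment_avg k c m F (x(i := s))) has_real_derivative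
    segment_avg k c (if i = k then Suc m else m) (partial_deriv i F) x) (at (x i))"
proof -
  obtain \<delta> where d: "0 < \<delta>" "\<forall>s\<in>ball (x i) \<delta>. x(i := s) \<in> W"
    using coord_line_in_open[OF W(1) x i] by blast
  define U where "U = ball (x i) \<delta>"
  define m' where "m' = (if i = k then Suc m else m)"
  have u: "continuous_on U (\<lambda>s. x(i := s))" "(\<lambda>s. x(i := s)) ` U \<subseteq> W"
    using d by (auto simp: U_def intro: continuous_on_coord_line simp del: mem_ball)
  have cF: "continuous_on W F" and cD: "continuous_on W (partial_deriv i F)"
    using C_k_on_imp_continuous_on[OF F W(1)] F i C_k_on_imp_continuous_on[OF _ W(1), of 0]
    by auto
  define y where "y s t = (x(i := s))(k := c + t * ((x(i := s)) k - c))" for s t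
  have yW: "y s t \<in> W" if "s \<in> U" "t \<in> {0..1}" for s t
    using u(2) W(2) that unfolding y_def segment_closed_def by blast
  have "((\<lambda>s. integral (cbox 0 1) (\<lambda>t. t ^ m * F (y s t))) has_real_derivative
      integral (cbox 0 1) (\<lambda>t. t ^ m' * partial_deriv i F (y (x i) t))) (at (x i) within U)"
  proof (rule leibniz_rule_field_derivative)
    show "((\<lambda>s. t ^ m * F (y s t)) has_real_derivative t ^ m' * partial_deriv i F (y s t)) (at s within U)"
      if s: "s \<in> U" and t: "t \<in> cbox 0 1" for s t
    proof -
      have D: "((\<lambda>r. F ((y s t)(i := r))) has_real_derivative partial_deriv i F (y s t))
          (at (y s t i))"
        using C_k_on_has_partial[OF F _ i] yW[OF s] t by auto
      \<comment> \<open>\<open>h r\<close> is coordinate \<open>i\<close> of the point of parameter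
        \<open>t\<close> on the segment, once \<open>x i\<close> has been replaced by
        \<open>r\<close>. Its derivative is the inner factor of the one-dimensional chain
        rule.\<close>
      define h where "h = (\<lambda>r. if i = k then c + t * (r - c) else r)"
      have "(h has_real_derivative (if i = k then t else 1)) (at s)"
        unfolding h_def by (cases "i = k") (auto intro!: derivative_eq_intros)
      moreover have "h s = y s t i"
        by (auto simp: h_def y_def)
      ultimately have "((\<lambda>s'. F ((y s t)(i := h s'))) has_real_derivative
          partial_deriv i F (y s t) * (if i = k then t else 1)) (at s)"
        using DERIV_chain2[of "\<lambda>r. F ((y s t)(i := r))"] D by metis
      moreover have "(y s t)(i := h s') = y s' t" for s'
        by (auto simp: h_def y_def fun_eq_iff)
      ultimately have "((\<lambda>s'. F (y s' t)) has_real_derivative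
          partial_deriv i F (y s t) * (if i = k then t else 1)) (at s)"
        by simp
      then have "((\<lambda>s'. t ^ m * F (y s' t)) has_real_derivative
          t ^ m * (partial_deriv i F (y s t) * (if i = k then t else 1))) (at s)"
        by (rule DERIV_cmult)
      then show ?thesis
        by (rule has_field_derivative_at_within[OF DERIV_cong]) (simp add: m'_def ac_simps split: if_splits)
    qed
    show "(\<lambda>t. t ^ m * F (y s t)) integrable_on cbox 0 1" if "s \<in> U" for s
    proof (rule integrable_continuous)
      have c: "continuous_on (U \<times> cbox 0 1) (\<lambda>(s, t). t ^ m * F (y s t))"
        unfolding y_def by (rule continuous_on_segment_integrand[OF cF W(2) u])
      have "continuous_on (cbox 0 1) (\<lambda>t. case (s, t) of (s, t) \<Rightarrow> t ^ m * F (y s t))"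
        by (rule continuous_on_compose2[OF c]) (use that in \<open>auto intro: continuous_on_Pair\<close>)
      then show "continuous_on (cbox 0 1) (\<lambda>t. t ^ m * F (y s t))"
        by (simp only: case_prod_conv)
    qed
    show "continuous_on (U \<times> cbox 0 1) (\<lambda>(s, t). t ^ m' * partial_deriv i F (y s t))"
      unfolding y_def by (rule continuous_on_segment_integrand[OF cD W(2) u])
  qed (use d in \<open>auto simp: U_def\<close>)
  moreover have "at (x i) within U = at (x i)"
    by (rule at_within_open) (use d in \<open>auto simp: U_def\<close>)
  ultimately show ?thesis
    by (simp add: segment_avg_def y_def m'_def)
qed

text \<open>The exponent \<open>m\<close> is arbitrary in the induction, since differentiating in
  direction \<open>k\<close> replaces it by \<open>Suc m\<close>.\<close>

lemma C_k_on_segment_avg: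
  assumes W: "openin (Euclidean_space n) W" "segment_closed k c W"
  shows "C_k_on j n W F \<Longrightarrow> C_k_on j n W (segment_avg k c m F)"
proof (induction j arbitrary: F m)
  case 0
  then have "continuous_on W F"
    using C_k_on_imp_continuous_on W by blast
  then show ?case
    using continuous_on_segment_avg[OF _ W(2)] openin_subset[OF W(1)]
    by (simp add: continuous_map_Euclidean_space_subtopology)
next
  case (Suc j)
  have F1: "C_k_on (Suc 0) n W F"
    by (rule C_k_on_Suc_imp_1[OF W(1) Suc.prems])
  show ?case
  proof (rule C_k_on_SucI[OF W(1) _ partial_segment_avg[OF W F1]])
    show "continuous_on W (segment_avg k c m F)"
      by (rule continuous_on_segment_avg[OF C_k_on_imp_continuous_on[OF Suc.prems W(1)] W(2)])
    show "C_k_on j n W (segment_avg k c (if i = k then Suc m else m) (partial_deriv i F))"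
      if "i < n" for i
      using Suc.prems that by (intro Suc.IH) simp
  qed
qed

text \<open>The fundamental theorem of calculus on the segment from \<open>x(k := c)\<close> to
  \<open>x\<close>, parametrised over the unit interval; the speed \<open>x k - c\<close> comes out
  as a factor.\<close>

lemma segment_avg_FTC:
  assumes W: "openin (Euclidean_space n) W" "segment_closed k c W"
    and F: "C_k_on (Suc 0) n W F" and x: "x \<in> W" and k: "k < n"
  shows "F x - F (x(k := c)) = (x k - c) * segment_avg k c 0 (partial_deriv k F) x"
proof -
  define h where "h t = c + t * (x k - c)" for t
  have "((\<lambda>t. partial_deriv k F (x(k := h t)) * (x k - c)) has_integral
      F (x(k := h 1)) - F (x(k := h 0))) {0..1}"
  proof (rule fundamental_theorem_of_calculus)
    fix t :: real assume t: "t \<in> {0..1}"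
    then have "x(k := h t) \<in> W"
      using W(2) x unfolding segment_closed_def h_def by blast
    from C_k_on_has_partial[OF F this k]
    have "((\<lambda>r. F (x(k := r))) has_real_derivative partial_deriv k F (x(k := h t))) (at (h t))"
      by simp
    moreover have "(h has_real_derivative x k - c) (at t)"
      unfolding h_def by (auto intro!: derivative_eq_intros)
    ultimately have "((\<lambda>t. F (x(k := h t))) has_real_derivative
        partial_deriv k F (x(k := h t)) * (x k - c)) (at t)"
      by (rule DERIV_chain2)
    then show "((\<lambda>t. F (x(k := h t))) has_vector_derivative
        partial_deriv k F (x(k := h t)) * (x k - c)) (at t within {0..1})"
      using has_real_derivative_iff_has_vector_derivative has_vector_derivative_at_within by blast
  qed simp
  from integral_unique[OF this] show ?thesis
    by (simp add: segment_avg_def h_def mult.commute)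
qed

lemma segment_avg_center: "x k = c \<Longrightarrow> segment_avg k c 0 F x = F x"
  by (auto simp: segment_avg_def fun_upd_idem)

section \<open>Hadamard's lemma\<close>

definition set_coords :: "nat \<Rightarrow> (nat \<Rightarrow> real) \<Rightarrow> (nat \<Rightarrow> real) \<Rightarrow> nat \<Rightarrow> real"
  where "set_coords k a x = (\<lambda>i. if i < k then a i else x i)"

lemma continuous_on_set_coords: "continuous_on S (set_coords k a)"
proof (rule continuous_on_coordinatewise_then_product)
  show "continuous_on S (\<lambda>x. set_coords k a x i)" for i
    by (cases "i < k") (simp_all add: set_coords_def continuous_on_coord)
qed

text \<open>Coordinates below \<open>k\<close> are frozen and the others untouched, so the partial
  derivatives can be read off. The argument is direct because the general chain rule rests on
  Hadamard's lemma, which in turn uses this fact.\<close>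

lemma C_k_on_set_coords:
  assumes W: "openin (Euclidean_space n) W" "set_coords k a ` W \<subseteq> W"
  shows "C_k_on j n W F \<Longrightarrow> C_k_on j n W (\<lambda>x. F (set_coords k a x))"
proof (induction j arbitrary: F)
  case 0
  then show ?case
    using C_k_on_imp_continuous_on[OF 0 W(1)] openin_subset[OF W(1)] W(2)
    by (auto simp: continuous_map_Euclidean_space_subtopology
        intro: continuous_on_compose2[OF _ continuous_on_set_coords])
next
  case (Suc j)
  show ?case
  proof (rule C_k_on_SucI[OF W(1),
        where D = "\<lambda>i x. if i < k then 0 else partial_deriv i F (set_coords k a x)"])
    show "continuous_on W (\<lambda>x. F (set_coords k a x))"
      by (rule continuous_on_compose2[OF C_k_on_imp_continuous_on[OF Suc.prems W(1)]
            continuous_on_set_coords W(2)])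
    show "((\<lambda>t. F (set_coords k a (x(i := t)))) has_real_derivative
        (if i < k then 0 else partial_deriv i F (set_coords k a x))) (at (x i))"
      if x: "x \<in> W" and i: "i < n" for x i
    proof (cases "i < k")
      case True
      then have "set_coords k a (x(i := t)) = set_coords k a x" for t
        by (auto simp: set_coords_def)
      then show ?thesis using True by simp
    next
      case False
      then have "set_coords k a (x(i := t)) = (set_coords k a x)(i := t)" for t
        by (auto simp: set_coords_def)
      moreover have "set_coords k a x i = x i"
        using False by (simp add: set_coords_def)
      moreover have "set_coords k a x \<in> W"
        using x W(2) by blast
      ultimately show ?thesis
        using C_k_on_has_partial[OF Suc.prems _ i, of "set_coords k a x"] False by (simp del: fun_upd_apply)
    qed
    show "C_k_on j n W (\<lambda>x. if i < k then 0 else partial_deriv i F (set_coords k a x))"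
      if "i < n" for i
      using Suc.prems that by (cases "i < k") (simp_all add: C_k_on_const[OF W(1)] Suc.IH)
  qed
qed

lemma coord_box_segment_closed:
  assumes "i < n"
  shows "segment_closed i (a i) (coord_box n a \<epsilon>)"
  unfolding segment_closed_def
proof (intro ballI)
  fix x and t :: real assume x: "x \<in> coord_box n a \<epsilon>" and t: "t \<in> {0..1}"
  have "\<bar>t * (x i - a i)\<bar> \<le> \<bar>x i - a i\<bar>"
    using t by (simp add: abs_mult mult_left_le_one_le)
  then show "x(i := a i + t * (x i - a i)) \<in> coord_box n a \<epsilon>"
    using x assms by (force simp: coord_box_def topspace_Euclidean_space)
qed

lemma coord_box_set_coords:
  assumes "a \<in> topspace (Euclidean_space n)"
  shows "set_coords k a ` coord_box n a \<epsilon> \<subseteq> coord_box n a \<epsilon>"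
  using assms by (fastforce simp: coord_box_def set_coords_def topspace_Euclidean_space)

text \<open>The same factors \<open>H\<close> serve every class \<open>k\<close>, with the loss of
  one derivative. Hence a smooth \<open>F\<close> has smooth factors, and an \<open>F\<close> with
  merely continuous first derivatives still has continuous ones.\<close>

lemma Hadamard:
  assumes a: "a \<in> topspace (Euclidean_space n)"
    and F: "C_k_on (Suc 0) n (coord_box n a \<epsilon>) F"
  obtains H where
    "\<And>x. x \<in> coord_box n a \<epsilon> \<Longrightarrow> F x = F a + (\<Sum>i<n. (x i - a i) * H i x)"
    "\<And>i. i < n \<Longrightarrow> H i a = partial_deriv i F a"
    "\<And>i k. \<lbrakk>i < n; C_k_on (Suc k) n (coord_box n a \<epsilon>) F\<rbrakk> \<Longrightarrow> C_k_on k n (coord_box n a \<epsilon>) (H i)"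
proof
  define B where "B = coord_box n a \<epsilon>"
  have B: "openin (Euclidean_space n) B"
    by (simp add: B_def openin_coord_box)
  \<comment> \<open>Factor \<open>i\<close> belongs to the move from \<open>set_coords i a x\<close>
    to \<open>set_coords (Suc i) a x\<close>: the coordinates below \<open>i\<close> already agree
    with \<open>a\<close>, and coordinate \<open>i\<close> now goes to \<open>a i\<close>. The
    increments telescope from \<open>x\<close> to \<open>a\<close>.\<close>
  define H where "H i x = segment_avg i (a i) 0 (partial_deriv i F) (set_coords i a x)" for i x
  show "F x = F a + (\<Sum>i<n. (x i - a i) * H i x)" if x: "x \<in> coord_box n a \<epsilon>" for x
  proof -
    have "F (set_coords i a x) - F (set_coords (Suc i) a x) = (x i - a i) * H i x" if "i < n" for i
    proof -
      have "set_coords i a x \<in> B"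
        using coord_box_set_coords[OF a] x unfolding B_def by blast
      from segment_avg_FTC[OF B _ F[folded B_def] this that, of "a i"]
      have "F (set_coords i a x) - F ((set_coords i a x)(i := a i)) = (x i - a i) * H i x"
        using coord_box_segment_closed[OF that] by (simp add: H_def B_def set_coords_def)
      moreover have "(set_coords i a x)(i := a i) = set_coords (Suc i) a x"
        by (auto simp: set_coords_def fun_eq_iff)
      ultimately show ?thesis by simp
    qed
    then have "(\<Sum>i<n. (x i - a i) * H i x)
        = (\<Sum>i<n. F (set_coords i a x) - F (set_coords (Suc i) a x))"
      by simp
    also have "\<dots> = F (set_coords 0 a x) - F (set_coords n a x)"
      by (rule sum_lessThan_telescope')
    also have "set_coords 0 a x = x"
      by (simp add: set_coords_def)
    also have "set_coords n a x = a"
      using x a by (auto simp: set_coords_def fun_eq_iff coord_box_def topspace_Euclidean_space)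
    finally show ?thesis by simp
  qed
  show "H i a = partial_deriv i F a" for i
    by (simp add: H_def set_coords_def segment_avg_center)
  show "C_k_on k n (coord_box n a \<epsilon>) (H i)"
    if i: "i < n" and k: "C_k_on (Suc k) n (coord_box n a \<epsilon>) F" for i k
  proof -
    have "C_k_on k n B (partial_deriv i F)"
      using i k by (simp add: B_def)
    then have "C_k_on k n B (segment_avg i (a i) 0 (partial_deriv i F))"
      using C_k_on_segment_avg[OF B] coord_box_segment_closed[OF i] by (simp add: B_def)
    from C_k_on_set_coords[OF B _ this] show ?thesis
      using coord_box_set_coords[OF a] by (simp add: B_def H_def[abs_def])
  qed
qed

section \<open>The chain rule\<close>

lemma continuous_on_coords:
  assumes W: "openin (Euclidean_space n) W" and u: "u ` W \<subseteq> topspace (Euclidean_space n)"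
    and c: "\<And>j. j < n \<Longrightarrow> C_k_on k n W (\<lambda>x. u x j)"
  shows "continuous_on W u"
proof (rule continuous_on_coordinatewise_then_product)
  fix j
  show "continuous_on W (\<lambda>x. u x j)"
  proof (cases "j < n")
    case True
    then show ?thesis
      using C_k_on_imp_continuous_on[OF c W] by blast
  next
    case False
    then have "u x j = 0" if "x \<in> W" for x
      using u that by (auto simp: topspace_Euclidean_space)
    then show ?thesis by (simp cong: continuous_on_cong)
  qed
qed

text \<open>\<open>K\<close> is only continuous at \<open>x\<close>, so the product rule is out of
  reach. But \<open>f t - f x\<close> vanishes at \<open>x\<close>, and Caratheodory's slope
  function \<open>q\<close> of \<open>f\<close> makes \<open>q z * K z\<close> a slope of the
  product that is continuous at \<open>x\<close>.\<close>

lemma DERIV_mult_vanishing: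
  fixes f K :: "real \<Rightarrow> real"
  assumes "(f has_real_derivative D) (at x)" "isCont K x"
  shows "((\<lambda>t. (f t - f x) * K t) has_real_derivative D * K x) (at x)"
proof -
  obtain q where "\<forall>z. f z - f x = q z * (z - x)" "isCont q x" "q x = D"
    using assms(1) CARAT_DERIV by blast
  then show ?thesis
    using assms(2)
    by (subst CARAT_DERIV) (intro exI[of _ "\<lambda>z. q z * K z"], auto intro!: continuous_intros)
qed

text \<open>Hadamard's expansion of \<open>F\<close> at \<open>u x\<close>, taken along the
  coordinate line, reduces the claim to products of a differentiable function vanishing at
  \<open>x i\<close> with a continuous one.\<close>

lemma chain_rule_partial:
  assumes W: "openin (Euclidean_space n) W" and V: "openin (Euclidean_space n) V"
    and u: "u ` W \<subseteq> V" "\<And>j. j < n \<Longrightarrow> C_k_on (Suc 0) n W (\<lambda>x. u x j)"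
    and F: "C_k_on (Suc 0) n V F" and x: "x \<in> W" and i: "i < n"
  shows "((\<lambda>t. F (u (x(i := t)))) has_real_derivative
    (\<Sum>j<n. partial_deriv i (\<lambda>x. u x j) x * partial_deriv j F (u x))) (at (x i))"
proof -
  define a where "a = u x"
  have aV: "a \<in> V" and a: "a \<in> topspace (Euclidean_space n)"
    using u(1) x openin_subset[OF V] by (auto simp: a_def)
  obtain \<epsilon> where e: "0 < \<epsilon>" "coord_box n a \<epsilon> \<subseteq> V"
    using coord_box_within_open[OF V aV] .
  define B where "B = coord_box n a \<epsilon>"
  have B: "openin (Euclidean_space n) B" "a \<in> B"
    using openin_coord_box coord_box_center[OF a e(1)] by (auto simp: B_def)
  have FB: "C_k_on (Suc 0) n B F"
    using C_k_on_subset[OF _ F] e by (simp add: B_def)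
  obtain H where H: "\<And>y. y \<in> B \<Longrightarrow> F y = F a + (\<Sum>j<n. (y j - a j) * H j y)"
      "\<And>j. j < n \<Longrightarrow> H j a = partial_deriv j F a" "\<And>j. j < n \<Longrightarrow> C_k_on 0 n B (H j)"
    using Hadamard[OF a FB[unfolded B_def]] FB unfolding B_def by metis
  obtain \<delta> where d: "0 < \<delta>" "\<forall>t\<in>ball (x i) \<delta>. x(i := t) \<in> W"
    using coord_line_in_open[OF W x i] by blast
  define I where "I = ball (x i) \<delta>"
  define c where "c t = u (x(i := t))" for t
  have cx: "c (x i) = a"
    by (simp add: c_def a_def)
  have cI: "c ` I \<subseteq> V"
    using d u(1) by (auto simp: I_def c_def simp del: mem_ball)
  have cont: "continuous_on I c"
    unfolding c_def
  proof (rule continuous_on_compose2[OF _ continuous_on_coord_line])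
    show "continuous_on W u"
      by (rule continuous_on_coords[OF W _ u(2)]) (use u(1) openin_subset[OF V] in auto)
    show "(\<lambda>t. x(i := t)) ` I \<subseteq> W"
      using d unfolding I_def by blast
  qed
  \<comment> \<open>The expansion of \<open>F\<close> holds only while the curve \<open>c\<close>
    stays in the cube; \<open>J\<close> must be open for this to determine the derivative.\<close>
  define J where "J = {t \<in> I. c t \<in> B}"
  obtain T where T: "open T" "B = T \<inter> topspace (Euclidean_space n)"
    using B openin_Euclidean_space by blast
  have "J = I \<inter> c -` T"
    using cI openin_subset[OF V] T by (auto simp: J_def)
  then have J: "open J"
    using continuous_open_preimage[OF cont _ T(1)] by (simp add: I_def)
  have xJ: "x i \<in> J"
    using d B by (simp add: J_def I_def cx)
  have "((\<lambda>t. F a + (\<Sum>j<n. (c t j - c (x i) j) * H j (c t))) has_real_derivative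
      0 + (\<Sum>j<n. partial_deriv i (\<lambda>x. u x j) x * H j (c (x i)))) (at (x i))"
  proof (intro DERIV_add DERIV_const DERIV_sum DERIV_mult_vanishing)
    fix j assume "j \<in> {..<n}"
    then have j: "j < n" by simp
    show "((\<lambda>t. c t j) has_real_derivative partial_deriv i (\<lambda>x. u x j) x) (at (x i))"
      unfolding c_def by (rule C_k_on_has_partial[OF u(2)[OF j] x i])
    have "continuous_on J (\<lambda>t. H j (c t))"
      by (rule continuous_on_compose2[OF C_k_on_imp_continuous_on[OF H(3)[OF j] B(1)]
            continuous_on_subset[OF cont]]) (auto simp: J_def)
    then show "isCont (\<lambda>t. H j (c t)) (x i)"
      using J xJ continuous_on_eq_continuous_at by blast
  qed
  then have "((\<lambda>t. F a + (\<Sum>j<n. (c t j - c (x i) j) * H j (c t))) has_real_derivative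
      (\<Sum>j<n. partial_deriv i (\<lambda>x. u x j) x * partial_deriv j F (u x))) (at (x i))"
    by (simp add: cx H(2) a_def[symmetric])
  then show ?thesis
  proof (rule has_field_derivative_transform_within_open[OF _ J xJ])
    fix t assume "t \<in> J"
    then show "F a + (\<Sum>j<n. (c t j - c (x i) j) * H j (c t)) = F (u (x(i := t)))"
      using H(1)[of "c t"] cx by (simp add: J_def c_def)
  qed
qed

text \<open>The chain rule writes each partial derivative as a sum of products of functions of class
  \<open>k\<close>. The factors \<open>partial_deriv j F (u x)\<close> come from the induction
  hypothesis, hence the arbitrary \<open>F\<close>.\<close>

lemma C_k_on_compose:
  assumes W: "openin (Euclidean_space n) W" and V: "openin (Euclidean_space n) V"
    and u: "u ` W \<subseteq> V"
  shows "\<lbrakk>\<And>j. j < n \<Longrightarrow> C_k_on k n W (\<lambda>x. u x j); C_k_on k n V F\<rbrakk> \<Longrightarrow> C_k_on k n W (\<lambda>x. F (u x))"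
proof (induction k arbitrary: F)
  case 0
  have "continuous_on W u"
    by (rule continuous_on_coords[OF W _ 0(1)]) (use u openin_subset[OF V] in auto)
  then have "continuous_on W (\<lambda>x. F (u x))"
    by (rule continuous_on_compose2[OF C_k_on_imp_continuous_on[OF 0(2) V] _ u])
  then show ?case
    using openin_subset[OF W] by (simp add: continuous_map_Euclidean_space_subtopology)
next
  case (Suc k)
  have "continuous_on W u"
    by (rule continuous_on_coords[OF W _ Suc.prems(1)]) (use u openin_subset[OF V] in auto)
  then have cont: "continuous_on W (\<lambda>x. F (u x))"
    by (rule continuous_on_compose2[OF C_k_on_imp_continuous_on[OF Suc.prems(2) V] _ u])
  show ?case
  proof (rule C_k_on_SucI[OF W cont chain_rule_partial[OF W V u
          C_k_on_Suc_imp_1[OF W Suc.prems(1)] C_k_on_Suc_imp_1[OF V Suc.prems(2)]]])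
    show "C_k_on k n W (\<lambda>x. \<Sum>j<n. partial_deriv i (\<lambda>x. u x j) x * partial_deriv j F (u x))"
      if i: "i < n" for i
    proof (intro C_k_on_sum C_k_on_mult W)
      fix j assume "j \<in> {..<n}"
      then have j: "j < n" by simp
      show "C_k_on k n W (partial_deriv i (\<lambda>x. u x j))"
        using Suc.prems(1)[OF j] i by simp
      show "C_k_on k n W (\<lambda>x. partial_deriv j F (u x))"
        by (rule Suc.IH[OF C_k_on_Suc_imp[OF W Suc.prems(1)]]) (use Suc.prems(2) j in simp_all)
    qed
  qed
qed


section \<open>Smooth functions, tangent vectors and sections\<close>

lemma C_infinity_on_cong:
  assumes "openin (Euclidean_space n) W" "C_infinity_on n W f" "\<And>x. x \<in> W \<Longrightarrow> f x = h x"
  shows "C_infinity_on n W h"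
  using C_k_on_cong[OF assms(1) assms(3)] assms(2) by (simp add: C_infinity_on_def)

lemma C_infinity_on_subset:
  assumes "C_infinity_on n W f" "V \<subseteq> W"
  shows "C_infinity_on n V f"
  using C_k_on_subset[OF assms(2)] assms(1) by (simp add: C_infinity_on_def)

lemma C_infinity_on_local:
  assumes "openin (Euclidean_space n) W"
    and "\<And>x. x \<in> W \<Longrightarrow> \<exists>V. openin (Euclidean_space n) V \<and> x \<in> V \<and> C_infinity_on n V f"
  shows "C_infinity_on n W f"
  unfolding C_infinity_on_def
proof
  fix k
  show "C_k_on k n W f"
    by (rule C_k_on_local[OF assms(1)]) (use assms(2) C_infinity_on_def in metis)
qed

lemma C_infinity_on_const: "openin (Euclidean_space n) W \<Longrightarrow> C_infinity_on n W (\<lambda>x. c)"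
  by (simp add: C_infinity_on_def C_k_on_const)

lemma C_infinity_on_add:
  "\<lbrakk>openin (Euclidean_space n) W; C_infinity_on n W f; C_infinity_on n W h\<rbrakk> \<Longrightarrow>
    C_infinity_on n W (\<lambda>x. f x + h x)"
  by (simp add: C_infinity_on_def C_k_on_add)

lemma C_infinity_on_mult:
  "\<lbrakk>openin (Euclidean_space n) W; C_infinity_on n W f; C_infinity_on n W h\<rbrakk> \<Longrightarrow>
    C_infinity_on n W (\<lambda>x. f x * h x)"
  by (simp add: C_infinity_on_def C_k_on_mult)

lemma C_infinity_on_sum:
  "\<lbrakk>openin (Euclidean_space n) W; \<And>a. a \<in> A \<Longrightarrow> C_infinity_on n W (f a)\<rbrakk> \<Longrightarrow>
    C_infinity_on n W (\<lambda>x. \<Sum>a\<in>A. f a x)"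
  by (simp add: C_infinity_on_def C_k_on_sum)

lemma C_infinity_on_partial:
  "\<lbrakk>C_infinity_on n W f; i < n\<rbrakk> \<Longrightarrow> C_infinity_on n W (partial_deriv i f)"
  unfolding C_infinity_on_def by (meson C_k_on.simps(2))

lemma C_infinity_on_compose:
  assumes "openin (Euclidean_space n) W" "openin (Euclidean_space n) V" "u ` W \<subseteq> V"
    and "\<And>j. j < n \<Longrightarrow> C_infinity_on n W (\<lambda>x. u x j)" "C_infinity_on n V F"
  shows "C_infinity_on n W (\<lambda>x. F (u x))"
  using C_k_on_compose[OF assms(1-3)] assms(4,5) by (simp add: C_infinity_on_def)

lemma sum_fun_apply: "(\<Sum>a\<in>A. f a) x = (\<Sum>a\<in>A. f a x)"
  by (induction A rule: infinite_finite_induct) auto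

lemma linear_on_subspace_add:
  "\<lbrakk>linear_on_subspace S L; u \<in> S; v \<in> S\<rbrakk> \<Longrightarrow> L (u + v) = L u + L v"
  by (simp add: linear_on_subspace_def)

lemma linear_on_subspace_scaleR:
  "\<lbrakk>linear_on_subspace S L; u \<in> S\<rbrakk> \<Longrightarrow> L (c *\<^sub>R u) = c *\<^sub>R L u"
  by (simp add: linear_on_subspace_def)

lemma linear_on_subspace_zero:
  assumes "subspace S" "linear_on_subspace S L"
  shows "L 0 = 0"
  using linear_on_subspace_scaleR[OF assms(2) subspace_0[OF assms(1)], of 0] by simp

lemma linear_on_subspace_sum:
  assumes S: "subspace S" and L: "linear_on_subspace S L"
  shows "(\<And>a. a \<in> A \<Longrightarrow> x a \<in> S) \<Longrightarrow> L (\<Sum>a\<in>A. x a) = (\<Sum>a\<in>A. L (x a))"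
  by (induction A rule: infinite_finite_induct)
    (simp_all add: linear_on_subspace_zero[OF S L] linear_on_subspace_add[OF L] subspace_sum[OF S])

lemma linear_on_subspace_combination:
  assumes S: "subspace S" and L: "linear_on_subspace S L" and x: "\<And>a. a \<in> A \<Longrightarrow> x a \<in> S"
  shows "L (\<Sum>a\<in>A. c a *\<^sub>R x a) = (\<Sum>a\<in>A. c a *\<^sub>R L (x a))"
  using linear_on_subspace_sum[OF S L, of A "\<lambda>a. c a *\<^sub>R x a"]
  by (simp add: x linear_on_subspace_scaleR[OF L] subspace_scale[OF S])

section \<open>Charts, smooth functions and derivations of germs\<close>

context smooth_manifold
begin

lemma chart_inj: "(U, \<phi>) \<in> \<A> \<Longrightarrow> inj_on \<phi> U"
  using homeomorphic_imp_injective_map[OF chart_homeo] by simp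

lemma chart_inv: "\<lbrakk>(U, \<phi>) \<in> \<A>; p \<in> U\<rbrakk> \<Longrightarrow> inv_into U \<phi> (\<phi> p) = p"
  using chart_inj by (simp add: inv_into_f_f)

text \<open>A chart is a homeomorphism onto an image that is itself open in
  \<open>Euclidean_space n\<close>, so relative openness in the image is openness.\<close>

lemma chart_image_open:
  assumes c: "(U, \<phi>) \<in> \<A>" and S: "open S"
  shows "openin (Euclidean_space n) (\<phi> ` (S \<inter> U))"
proof -
  have "openin (top_of_set U) (S \<inter> U)"
    using S by (auto simp: openin_open)
  then have "openin (subtopology (Euclidean_space n) (\<phi> ` U)) (\<phi> ` (S \<inter> U))"
    using homeomorphic_map_openness[OF chart_homeo[OF c], of "S \<inter> U"] by simp
  then show ?thesis
    using chart_image[OF c] openin_trans_full by blast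
qed

lemma chart_preimage_open:
  assumes c: "(U, \<phi>) \<in> \<A>" and W: "openin (Euclidean_space n) W"
  shows "open {q \<in> U. \<phi> q \<in> W}"
proof -
  have "openin (subtopology (Euclidean_space n) (\<phi> ` U)) (W \<inter> \<phi> ` U)"
    using W by (auto simp: openin_subtopology)
  from openin_continuous_map_preimage[OF homeomorphic_imp_continuous_map[OF chart_homeo[OF c]] this]
  have "openin (top_of_set U) {q \<in> U. \<phi> q \<in> W \<inter> \<phi> ` U}"
    by simp
  moreover have "{q \<in> U. \<phi> q \<in> W \<inter> \<phi> ` U} = {q \<in> U. \<phi> q \<in> W}"
    by blast
  ultimately show ?thesis
    using openin_open_eq[OF chart_domain[OF c]] by simp
qed

lemma smooth_funsD:
  "\<lbrakk>f \<in> smooth_funs n \<A> S; (U, \<phi>) \<in> \<A>\<rbrakk> \<Longrightarrow>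
    C_infinity_on n (\<phi> ` (S \<inter> U)) (\<lambda>x. f (inv_into U \<phi> x))"
  by (auto simp: smooth_funs_def)

lemma smooth_funsI:
  "(\<And>U \<phi>. (U, \<phi>) \<in> \<A> \<Longrightarrow> C_infinity_on n (\<phi> ` (S \<inter> U)) (\<lambda>x. f (inv_into U \<phi> x))) \<Longrightarrow>
    f \<in> smooth_funs n \<A> S"
  by (auto simp: smooth_funs_def)

lemma smooth_funs_const: "open S \<Longrightarrow> (\<lambda>p. c) \<in> smooth_funs n \<A> S"
  by (intro smooth_funsI C_infinity_on_const chart_image_open)

lemma smooth_funs_add:
  assumes "open S" "f \<in> smooth_funs n \<A> S" "h \<in> smooth_funs n \<A> S"
  shows "(\<lambda>p. f p + h p) \<in> smooth_funs n \<A> S"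
  by (rule smooth_funsI, rule C_infinity_on_add)
    (use assms in \<open>simp_all add: chart_image_open smooth_funsD\<close>)

lemma smooth_funs_mult:
  assumes "open S" "f \<in> smooth_funs n \<A> S" "h \<in> smooth_funs n \<A> S"
  shows "(\<lambda>p. f p * h p) \<in> smooth_funs n \<A> S"
  by (rule smooth_funsI, rule C_infinity_on_mult)
    (use assms in \<open>simp_all add: chart_image_open smooth_funsD\<close>)

lemma smooth_funs_sum:
  assumes "open S" "\<And>a. a \<in> A \<Longrightarrow> f a \<in> smooth_funs n \<A> S"
  shows "(\<lambda>p. \<Sum>a\<in>A. f a p) \<in> smooth_funs n \<A> S"
  using assms(2)
  by (induction A rule: infinite_finite_induct)
    (simp_all add: smooth_funs_const smooth_funs_add assms(1))

lemma smooth_funs_subset: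
  assumes "f \<in> smooth_funs n \<A> S" "T \<subseteq> S"
  shows "f \<in> smooth_funs n \<A> T"
  using assms(2)
  by (intro smooth_funsI C_infinity_on_subset[OF smooth_funsD[OF assms(1)]]) auto

lemma smooth_funs_cong:
  assumes S: "open S" and f: "f \<in> smooth_funs n \<A> S" and eq: "\<And>p. p \<in> S \<Longrightarrow> f p = h p"
  shows "h \<in> smooth_funs n \<A> S"
proof (rule smooth_funsI)
  fix U \<phi> assume c: "(U, \<phi>) \<in> \<A>"
  show "C_infinity_on n (\<phi> ` (S \<inter> U)) (\<lambda>x. h (inv_into U \<phi> x))"
    by (rule C_infinity_on_cong[OF chart_image_open[OF c S] smooth_funsD[OF f c]])
      (auto simp: eq chart_inv[OF c])
qed

lemma smooth_funs_local:
  assumes S: "open S" and loc: "\<And>p. p \<in> S \<Longrightarrow> \<exists>T. open T \<and> p \<in> T \<and> f \<in> smooth_funs n \<A> T"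
  shows "f \<in> smooth_funs n \<A> S"
proof (rule smooth_funsI)
  fix U \<phi> assume c: "(U, \<phi>) \<in> \<A>"
  show "C_infinity_on n (\<phi> ` (S \<inter> U)) (\<lambda>x. f (inv_into U \<phi> x))"
  proof (rule C_infinity_on_local[OF chart_image_open[OF c S]])
    fix x assume "x \<in> \<phi> ` (S \<inter> U)"
    then obtain p where p: "p \<in> S" "p \<in> U" "x = \<phi> p" by blast
    then obtain T where T: "open T" "p \<in> T" "f \<in> smooth_funs n \<A> T"
      using loc by blast
    then show "\<exists>V. openin (Euclidean_space n) V \<and> x \<in> V \<and>
        C_infinity_on n V (\<lambda>x. f (inv_into U \<phi> x))"
      using chart_image_open[OF c T(1)] smooth_funsD[OF T(3) c] p by blast
  qed
qed

lemma smooth_funs_coord: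
  assumes "(U, \<phi>) \<in> \<A>" "i < n"
  shows "(\<lambda>q. \<phi> q i) \<in> smooth_funs n \<A> U"
  using chart_compatible[OF _ assms] by (intro smooth_funsI) (simp add: Int_commute)

text \<open>In any other chart the function is \<open>G\<close> after a transition map, which is
  smooth by compatibility of the atlas. This carries the Hadamard factors back to the
  manifold.\<close>

lemma smooth_funs_chart_compose:
  assumes c: "(U, \<phi>) \<in> \<A>" and W: "openin (Euclidean_space n) W" and G: "C_infinity_on n W G"
  shows "(\<lambda>q. G (\<phi> q)) \<in> smooth_funs n \<A> {q \<in> U. \<phi> q \<in> W}"
proof (rule smooth_funsI)
  fix V \<psi> assume d: "(V, \<psi>) \<in> \<A>"
  define S where "S = {q \<in> U. \<phi> q \<in> W}"
  have S: "open S" "S \<subseteq> U"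
    using chart_preimage_open[OF c W] by (auto simp: S_def)
  have "C_infinity_on n (\<psi> ` (S \<inter> V)) (\<lambda>x. \<phi> (inv_into V \<psi> x) j)" if "j < n" for j
    by (rule smooth_funsD[OF smooth_funs_subset[OF smooth_funs_coord[OF c that] S(2)] d])
  moreover have "(\<lambda>x. \<phi> (inv_into V \<psi> x)) ` \<psi> ` (S \<inter> V) \<subseteq> W"
    by (auto simp: S_def chart_inv[OF d])
  ultimately show "C_infinity_on n (\<psi> ` ({q \<in> U. \<phi> q \<in> W} \<inter> V)) (\<lambda>x. G (\<phi> (inv_into V \<psi> x)))"
    using C_infinity_on_compose[OF chart_image_open[OF d S(1)] W _ _ G, of "\<lambda>x. \<phi> (inv_into V \<psi> x)"]
    by (simp add: S_def)
qed

lemma subspace_C_infinity: "subspace (C_infinity n \<A>)"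
proof (rule subspaceI)
  show "0 \<in> C_infinity n \<A>"
    using smooth_funs_const[of UNIV 0] by (simp add: zero_fun_def)
  show "f + h \<in> C_infinity n \<A>" if "f \<in> C_infinity n \<A>" "h \<in> C_infinity n \<A>" for f h
    using smooth_funs_add[OF _ that] by (simp add: plus_fun_def)
  show "c *\<^sub>R f \<in> C_infinity n \<A>" if "f \<in> C_infinity n \<A>" for c f
    using smooth_funs_mult[OF _ smooth_funs_const that] by (simp add: scaleR_fun_def)
qed

lemma smooth_nearI: "\<lbrakk>f \<in> smooth_funs n \<A> S; open S; p \<in> S\<rbrakk> \<Longrightarrow> f \<in> smooth_near n \<A> p"
  by (auto simp: smooth_near_def)

lemma C_infinity_smooth_near: "f \<in> C_infinity n \<A> \<Longrightarrow> f \<in> smooth_near n \<A> p"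
  by (rule smooth_nearI[of f UNIV]) auto

lemma tangent_add:
  assumes "v \<in> tangent_space n \<A> p" "f \<in> smooth_near n \<A> p" "h \<in> smooth_near n \<A> p"
  shows "v (\<lambda>q. f q + h q) = v f + v h"
  using assms by (simp add: tangent_space_def linear_on_subspace_def plus_fun_def)

lemma tangent_mult:
  assumes "v \<in> tangent_space n \<A> p" "f \<in> smooth_near n \<A> p" "h \<in> smooth_near n \<A> p"
  shows "v (\<lambda>q. f q * h q) = f p * v h + h p * v f"
proof -
  have "v (f * h) = f p * v h + h p * v f"
    using assms by (simp add: tangent_space_def)
  then show ?thesis by (simp add: func_times)
qed

lemma tangent_scaleR:
  assumes "v \<in> tangent_space n \<A> p" "f \<in> smooth_near n \<A> p"
  shows "v (c *\<^sub>R f) = c * v f"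
  using assms by (simp add: tangent_space_def linear_on_subspace_def)

lemma smooth_near_const: "(\<lambda>q. c) \<in> smooth_near n \<A> p"
  by (rule smooth_nearI[OF smooth_funs_const[OF open_UNIV]]) auto

text \<open>The product rule for \<open>1 * 1 = 1\<close> gives \<open>v 1 = 2 * v 1\<close>, so
  \<open>v\<close> kills 1 and, by homogeneity, every constant.\<close>

lemma tangent_const:
  assumes "v \<in> tangent_space n \<A> p"
  shows "v (\<lambda>q. c) = 0"
  using tangent_mult[OF assms smooth_near_const smooth_near_const, of 1 1]
    tangent_scaleR[OF assms smooth_near_const, of c 1]
  by (simp add: scaleR_fun_def)

lemma tangent_sum:
  assumes v: "v \<in> tangent_space n \<A> p" and S: "open S" "p \<in> S"
  shows "(\<And>a. a \<in> A \<Longrightarrow> f a \<in> smooth_funs n \<A> S) \<Longrightarrow> v (\<lambda>q. \<Sum>a\<in>A. f a q) = (\<Sum>a\<in>A. v (f a))"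
proof (induction A rule: infinite_finite_induct)
  case (insert a A)
  have "v (\<lambda>q. f a q + (\<Sum>a\<in>A. f a q)) = v (f a) + v (\<lambda>q. \<Sum>a\<in>A. f a q)"
    using insert.prems by (intro tangent_add[OF v] smooth_nearI[OF _ S] smooth_funs_sum[OF S(1)]) auto
  then show ?case
    using insert by simp
qed (simp_all add: tangent_const[OF v])

lemma tangent_germ:
  assumes "v \<in> tangent_space n \<A> p" "f \<in> smooth_near n \<A> p" "h \<in> smooth_near n \<A> p"
    "open S" "p \<in> S" "\<And>q. q \<in> S \<Longrightarrow> f q = h q"
  shows "v f = v h"
  using assms unfolding tangent_space_def by blast

text \<open>Hadamard's lemma at \<open>\<phi> p\<close> writes \<open>f\<close> near
  \<open>p\<close> as a constant plus products of \<open>\<phi> q i + - a i\<close> with smooth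
  functions. A derivation kills the constant, and as the first factor of each product vanishes at
  \<open>p\<close>, only its derivative times the value of \<open>H i\<close> at \<open>a\<close>
  survives.\<close>

lemma tangent_vector_in_chart:
  assumes v: "v \<in> tangent_space n \<A> p" and c: "(U, \<phi>) \<in> \<A>" and p: "p \<in> U"
    and f: "f \<in> smooth_near n \<A> p"
  shows "v f = (\<Sum>i<n. v (\<lambda>q. \<phi> q i) * partial_deriv i (\<lambda>x. f (inv_into U \<phi> x)) (\<phi> p))"
proof -
  obtain S where S: "open S" "p \<in> S" "f \<in> smooth_funs n \<A> S"
    using f by (auto simp: smooth_near_def)
  define F where "F = (\<lambda>x. f (inv_into U \<phi> x))"
  define a where "a = \<phi> p"
  have W: "openin (Euclidean_space n) (\<phi> ` (S \<inter> U))" "a \<in> \<phi> ` (S \<inter> U)"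
    using chart_image_open[OF c S(1)] S(2) p by (auto simp: a_def)
  have a: "a \<in> topspace (Euclidean_space n)"
    using W openin_subset by blast
  obtain \<epsilon> where e: "0 < \<epsilon>" "coord_box n a \<epsilon> \<subseteq> \<phi> ` (S \<inter> U)"
    using coord_box_within_open[OF W] .
  define B where "B = coord_box n a \<epsilon>"
  have B: "openin (Euclidean_space n) B" "a \<in> B" "B \<subseteq> \<phi> ` (S \<inter> U)"
    using openin_coord_box coord_box_center[OF a e(1)] e(2) by (auto simp: B_def)
  have F: "C_infinity_on n B F"
    using C_infinity_on_subset[OF smooth_funsD[OF S(3) c] B(3)] by (simp add: F_def)
  then have Fk: "C_k_on k n (coord_box n a \<epsilon>) F" for k
    by (simp add: C_infinity_on_def B_def)
  obtain H where H: "\<And>x. x \<in> B \<Longrightarrow> F x = F a + (\<Sum>i<n. (x i - a i) * H i x)"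
      "\<And>i. i < n \<Longrightarrow> H i a = partial_deriv i F a" "\<And>i k. i < n \<Longrightarrow> C_k_on k n B (H i)"
    using Hadamard[OF a Fk] Fk unfolding B_def by metis
  define Q where "Q = {q \<in> U. \<phi> q \<in> B}"
  have Q: "open Q" "p \<in> Q" "Q \<subseteq> U"
    using chart_preimage_open[OF c B(1)] p B(2) by (auto simp: Q_def a_def)
  have h: "(\<lambda>q. H i (\<phi> q)) \<in> smooth_funs n \<A> Q" if "i < n" for i
    unfolding Q_def using H(3)[OF that]
    by (intro smooth_funs_chart_compose[OF c B(1)]) (simp add: C_infinity_on_def)
  have x: "(\<lambda>q. \<phi> q i) \<in> smooth_funs n \<A> Q" if "i < n" for i
    by (rule smooth_funs_subset[OF smooth_funs_coord[OF c that] Q(3)])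
  \<comment> \<open>Written as a sum with a constant, the form that the closure rules and
    \<open>tangent_add\<close> accept.\<close>
  have xa: "(\<lambda>q. \<phi> q i + - a i) \<in> smooth_funs n \<A> Q" if "i < n" for i
    by (intro smooth_funs_add smooth_funs_const x that Q(1))
  note near = smooth_nearI[OF _ Q(1,2)]
  have t: "(\<lambda>q. (\<phi> q i + - a i) * H i (\<phi> q)) \<in> smooth_funs n \<A> Q" if "i < n" for i
    by (intro smooth_funs_mult xa h that Q(1))
  have s: "(\<lambda>q. \<Sum>i<n. (\<phi> q i + - a i) * H i (\<phi> q)) \<in> smooth_funs n \<A> Q"
    by (intro smooth_funs_sum Q(1) t) auto
  \<comment> \<open>The expansion holds only on \<open>Q\<close>; tangent vectors depend on germs
    alone, which permits the replacement.\<close>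
  have "v f = v (\<lambda>q. F a + (\<Sum>i<n. (\<phi> q i + - a i) * H i (\<phi> q)))"
  proof (rule tangent_germ[OF v f _ Q(1,2)])
    show "(\<lambda>q. F a + (\<Sum>i<n. (\<phi> q i + - a i) * H i (\<phi> q))) \<in> smooth_near n \<A> p"
      by (intro near smooth_funs_add smooth_funs_const s Q(1))
    show "f q = F a + (\<Sum>i<n. (\<phi> q i + - a i) * H i (\<phi> q))" if "q \<in> Q" for q
      using H(1)[of "\<phi> q"] that by (simp add: Q_def F_def chart_inv[OF c])
  qed
  also have "\<dots> = v (\<lambda>q. \<Sum>i<n. (\<phi> q i + - a i) * H i (\<phi> q))"
    by (simp only: tangent_add[OF v smooth_near_const near[OF s]] tangent_const[OF v] add_0)
  also have "\<dots> = (\<Sum>i<n. v (\<lambda>q. (\<phi> q i + - a i) * H i (\<phi> q)))"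
    by (rule tangent_sum[OF v Q(1,2)]) (use t in auto)
  also have "\<dots> = (\<Sum>i<n. v (\<lambda>q. \<phi> q i) * partial_deriv i F (\<phi> p))"
  proof (rule sum.cong)
    fix i assume "i \<in> {..<n}"
    then have i: "i < n" by simp
    have "v (\<lambda>q. \<phi> q i + - a i) = v (\<lambda>q. \<phi> q i)"
      using tangent_add[OF v near[OF x[OF i]] smooth_near_const, of "- a i"]
      by (simp add: tangent_const[OF v])
    then show "v (\<lambda>q. (\<phi> q i + - a i) * H i (\<phi> q)) = v (\<lambda>q. \<phi> q i) * partial_deriv i F (\<phi> p)"
      using tangent_mult[OF v near[OF xa[OF i]] near[OF h[OF i]]] H(2)[OF i]
      by (simp add: a_def)
  qed simp
  finally show ?thesis by (simp add: F_def)
qed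

end

section \<open>Local frames, and smoothness of inner products and anchor actions\<close>

context smooth_vector_bundle
begin

lemma frame_in_fibre:
  assumes "(U, r, \<Phi>) \<in> \<T>" "p \<in> U" "a < r"
  shows "frame E \<Phi> a p \<in> E p" and "\<Phi> p (frame E \<Phi> a p) = (\<lambda>i. if i = a then 1 else 0)"
proof -
  have "(\<lambda>i. if i = a then 1 else 0) \<in> \<Phi> p ` E p"
    using triv_bij[OF assms(1,2)] assms(3) by (auto simp: bij_betw_def topspace_Euclidean_space)
  then show "frame E \<Phi> a p \<in> E p" "\<Phi> p (frame E \<Phi> a p) = (\<lambda>i. if i = a then 1 else 0)"
    unfolding frame_def by (rule inv_into_into, rule f_inv_into_f)
qed

text \<open>\<open>\<Phi> p\<close> is injective on the fibre, so it suffices to compare the images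
  of both sides, where the frame becomes the standard basis.\<close>

lemma frame_expansion:
  assumes t: "(U, r, \<Phi>) \<in> \<T>" and p: "p \<in> U" and u: "u \<in> E p"
  shows "u = (\<Sum>a<r. \<Phi> p u a *\<^sub>R frame E \<Phi> a p)"
proof -
  have f: "frame E \<Phi> a p \<in> E p" if "a \<in> {..<r}" for a
    using frame_in_fibre(1)[OF t p] that by simp
  have b: "bij_betw (\<Phi> p) (E p) (topspace (Euclidean_space r))"
    by (rule triv_bij[OF t p])
  have "\<Phi> p u = (\<Sum>a<r. \<Phi> p u a *\<^sub>R \<Phi> p (frame E \<Phi> a p))"
  proof
    fix i
    have "(\<Sum>a<r. \<Phi> p u a *\<^sub>R \<Phi> p (frame E \<Phi> a p)) i
        = (\<Sum>a<r. \<Phi> p u a * (if i = a then 1 else 0))"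
      by (simp add: sum_fun_apply frame_in_fibre(2)[OF t p])
    also have "(\<Sum>a<r. \<Phi> p u a * (if i = a then 1 else 0)) = (\<Sum>a<r. if i = a then \<Phi> p u a else 0)"
      by (rule sum.cong) auto
    also have "\<dots> = (if i < r then \<Phi> p u i else 0)"
      by simp
    also have "\<dots> = \<Phi> p u i"
      using bij_betwE[OF b] u by (auto simp: topspace_Euclidean_space)
    finally show "\<Phi> p u i = (\<Sum>a<r. \<Phi> p u a *\<^sub>R \<Phi> p (frame E \<Phi> a p)) i" ..
  qed
  also have "\<dots> = \<Phi> p (\<Sum>a<r. \<Phi> p u a *\<^sub>R frame E \<Phi> a p)"
    by (rule linear_on_subspace_combination[OF fibre_subspace triv_linear[OF t p] f, symmetric])
  finally show ?thesis
  proof (rule inj_onD[OF bij_betw_imp_inj_on[OF b] _ u])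
    show "(\<Sum>a<r. \<Phi> p u a *\<^sub>R frame E \<Phi> a p) \<in> E p"
      by (intro subspace_sum subspace_scale fibre_subspace f)
  qed
qed

text \<open>Smoothness of the anchor and of the metric is given on frames; this expansion carries it
  to arbitrary sections.\<close>

lemma linear_on_fibre_expansion:
  assumes t: "(U, r, \<Phi>) \<in> \<T>" and p: "p \<in> U" and u: "u \<in> E p"
    and L: "linear_on_subspace (E p) L"
  shows "L u = (\<Sum>a<r. \<Phi> p u a *\<^sub>R L (frame E \<Phi> a p))"
proof -
  have "L u = L (\<Sum>a<r. \<Phi> p u a *\<^sub>R frame E \<Phi> a p)"
    by (rule arg_cong[OF frame_expansion[OF t p u]])
  also have "\<dots> = (\<Sum>a<r. \<Phi> p u a *\<^sub>R L (frame E \<Phi> a p))"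
    using frame_in_fibre(1)[OF t p]
    by (intro linear_on_subspace_combination[OF fibre_subspace L]) simp
  finally show ?thesis .
qed

lemma smooth_section_in_fibre: "s \<in> smooth_sections n \<A> E \<T> \<Longrightarrow> s p \<in> E p"
  by (simp add: smooth_sections_def)

lemma smooth_section_component:
  "\<lbrakk>s \<in> smooth_sections n \<A> E \<T>; (U, r, \<Phi>) \<in> \<T>; i < r\<rbrakk> \<Longrightarrow>
    (\<lambda>p. \<Phi> p (s p) i) \<in> smooth_funs n \<A> U"
  by (fastforce simp: smooth_sections_def)

lemma smooth_sectionsI:
  "\<lbrakk>\<And>p. s p \<in> E p;
    \<And>U r \<Phi> i. \<lbrakk>(U, r, \<Phi>) \<in> \<T>; i < r\<rbrakk> \<Longrightarrow> (\<lambda>p. \<Phi> p (s p) i) \<in> smooth_funs n \<A> U\<rbrakk> \<Longrightarrow>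
    s \<in> smooth_sections n \<A> E \<T>"
  by (auto simp: smooth_sections_def)

lemma section_mult_closed:
  assumes f: "f \<in> C_infinity n \<A>" and s: "s \<in> smooth_sections n \<A> E \<T>"
  shows "section_mult f s \<in> smooth_sections n \<A> E \<T>"
proof (rule smooth_sectionsI)
  show "section_mult f s p \<in> E p" for p
    by (simp add: section_mult_def subspace_scale[OF fibre_subspace] smooth_section_in_fibre[OF s])
  fix U r \<Phi> i assume t: "(U, r, \<Phi>) \<in> \<T>" and i: "i < r"
  have "(\<lambda>p. f p * \<Phi> p (s p) i) \<in> smooth_funs n \<A> U"
    using smooth_funs_subset[OF f] smooth_section_component[OF s t i]
    by (intro smooth_funs_mult triv_domain[OF t]) auto
  then show "(\<lambda>p. \<Phi> p (section_mult f s p) i) \<in> smooth_funs n \<A> U"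
    by (rule smooth_funs_cong[OF triv_domain[OF t]])
      (simp add: section_mult_def linear_on_subspace_scaleR[OF triv_linear[OF t]] smooth_section_in_fibre[OF s])
qed

lemma subspace_smooth_sections: "subspace (smooth_sections n \<A> E \<T>)"
proof (rule subspaceI)
  have lin0: "\<Phi> p 0 = 0" if "(U, r, \<Phi>) \<in> \<T>" "p \<in> U" for U r \<Phi> p
    by (rule linear_on_subspace_zero[OF fibre_subspace triv_linear[OF that]])
  show "0 \<in> smooth_sections n \<A> E \<T>"
  proof (rule smooth_sectionsI)
    fix U r \<Phi> i assume t: "(U, r, \<Phi>) \<in> \<T>"
    show "(\<lambda>p. \<Phi> p ((0 :: 'm \<Rightarrow> 'e) p) i) \<in> smooth_funs n \<A> U"
      by (rule smooth_funs_cong[OF triv_domain[OF t] smooth_funs_const[OF triv_domain[OF t], of 0]])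
        (simp add: lin0[OF t])
  qed (simp add: subspace_0[OF fibre_subspace])
  show "s + s' \<in> smooth_sections n \<A> E \<T>"
    if s: "s \<in> smooth_sections n \<A> E \<T>" and s': "s' \<in> smooth_sections n \<A> E \<T>" for s s'
  proof (rule smooth_sectionsI)
    fix U r \<Phi> i assume t: "(U, r, \<Phi>) \<in> \<T>" and i: "i < r"
    show "(\<lambda>p. \<Phi> p ((s + s') p) i) \<in> smooth_funs n \<A> U"
      by (rule smooth_funs_cong[OF triv_domain[OF t] smooth_funs_add[OF triv_domain[OF t]
              smooth_section_component[OF s t i] smooth_section_component[OF s' t i]]])
        (simp add: linear_on_subspace_add[OF triv_linear[OF t]] smooth_section_in_fibre s s')
  qed (simp add: subspace_add[OF fibre_subspace] smooth_section_in_fibre s s')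
  show "c *\<^sub>R s \<in> smooth_sections n \<A> E \<T>" if "s \<in> smooth_sections n \<A> E \<T>" for c s
    using section_mult_closed[OF smooth_funs_const that, of c]
    by (simp add: section_mult_def scaleR_fun_def)
qed

lemma section_inner_closed:
  assumes g: "pseudo_euclidean_metric n \<A> E \<T> g"
    and s: "s \<in> smooth_sections n \<A> E \<T>" and s': "s' \<in> smooth_sections n \<A> E \<T>"
  shows "section_inner g s s' \<in> C_infinity n \<A>"
proof (rule smooth_funs_local)
  fix p
  obtain U r \<Phi> where t: "(U, r, \<Phi>) \<in> \<T>" "p \<in> U"
    using triv_cover[of p] by blast
  have lin: "linear_on_subspace (E q) (g q u)" if "u \<in> E q" for q u
    using g that by (simp add: pseudo_euclidean_metric_def)
  have sym: "g q u w = g q w u" if "u \<in> E q" "w \<in> E q" for q u w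
    using g that by (simp add: pseudo_euclidean_metric_def)
  have gf: "(\<lambda>q. g q (frame E \<Phi> a q) (frame E \<Phi> b q)) \<in> smooth_funs n \<A> U"
    if "a < r" "b < r" for a b
    using g t(1) that by (fastforce simp: pseudo_euclidean_metric_def)
  have "(\<lambda>q. \<Sum>a<r. \<Phi> q (s' q) a * (\<Sum>b<r. \<Phi> q (s q) b * g q (frame E \<Phi> a q) (frame E \<Phi> b q)))
      \<in> smooth_funs n \<A> U"
    using smooth_section_component[OF s t(1)] smooth_section_component[OF s' t(1)] gf
    by (intro smooth_funs_sum smooth_funs_mult triv_domain[OF t(1)]) auto
  then have "section_inner g s s' \<in> smooth_funs n \<A> U"
  proof (rule smooth_funs_cong[OF triv_domain[OF t(1)]])
    fix q assume q: "q \<in> U"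
    have "g q (s q) (s' q) = (\<Sum>a<r. \<Phi> q (s' q) a *\<^sub>R g q (s q) (frame E \<Phi> a q))"
      by (intro linear_on_fibre_expansion[OF t(1) q] lin smooth_section_in_fibre s s')
    also have "\<dots> = (\<Sum>a<r. \<Phi> q (s' q) a *\<^sub>R
        (\<Sum>b<r. \<Phi> q (s q) b *\<^sub>R g q (frame E \<Phi> a q) (frame E \<Phi> b q)))"
    proof (rule sum.cong)
      fix a assume "a \<in> {..<r}"
      then have f: "frame E \<Phi> a q \<in> E q"
        using frame_in_fibre(1)[OF t(1) q] by simp
      \<comment> \<open>Linearity of the metric is stated for its second argument; symmetry lets the
        first one be expanded as well.\<close>
      have "g q (s q) (frame E \<Phi> a q) = g q (frame E \<Phi> a q) (s q)"
        by (rule sym[OF smooth_section_in_fibre[OF s] f])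
      also have "\<dots> = (\<Sum>b<r. \<Phi> q (s q) b *\<^sub>R g q (frame E \<Phi> a q) (frame E \<Phi> b q))"
        by (rule linear_on_fibre_expansion[OF t(1) q smooth_section_in_fibre[OF s] lin[OF f]])
      finally show "\<Phi> q (s' q) a *\<^sub>R g q (s q) (frame E \<Phi> a q) = \<Phi> q (s' q) a *\<^sub>R
          (\<Sum>b<r. \<Phi> q (s q) b *\<^sub>R g q (frame E \<Phi> a q) (frame E \<Phi> b q))"
        by simp
    qed simp
    finally show "(\<Sum>a<r. \<Phi> q (s' q) a *
        (\<Sum>b<r. \<Phi> q (s q) b * g q (frame E \<Phi> a q) (frame E \<Phi> b q))) = section_inner g s s' q"
      by (simp add: section_inner_def)
  qed
  then show "\<exists>T. open T \<and> p \<in> T \<and> section_inner g s s' \<in> smooth_funs n \<A> T"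
    using t triv_domain by blast
qed simp

text \<open>In a chart, the vector field of \<open>s\<close> applied to \<open>f\<close> is the sum
  of its coefficients times the partial derivatives of \<open>f\<close>. So it remains to show that
  the coefficients, its values on the chart coordinates, are smooth.\<close>

lemma anchor_act_closed:
  assumes \<rho>: "smooth_bundle_map n \<A> E \<T> (tangent_space n \<A>) (tangent_triv n \<A>) \<rho>"
    and s: "s \<in> smooth_sections n \<A> E \<T>" and f: "f \<in> C_infinity n \<A>"
  shows "anchor_act \<rho> s f \<in> C_infinity n \<A>"
proof (rule smooth_funsI)
  fix V \<psi> assume c: "(V, \<psi>) \<in> \<A>"
  define F where "F = (\<lambda>x. f (inv_into V \<psi> x))"
  have V: "open V" by (rule chart_domain[OF c])
  have lin: "linear_on_subspace (E q) (\<rho> q)" and tan: "u \<in> E q \<Longrightarrow> \<rho> q u \<in> tangent_space n \<A> q" for q u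
    using \<rho> by (auto simp: smooth_bundle_map_def)
  have X: "(\<lambda>q. \<rho> q (s q) (\<lambda>q. \<psi> q i)) \<in> smooth_funs n \<A> V" if i: "i < n" for i
  proof (rule smooth_funs_local[OF V])
    fix p assume p: "p \<in> V"
    obtain U r \<Phi> where t: "(U, r, \<Phi>) \<in> \<T>" "p \<in> U"
      using triv_cover[of p] by blast
    have UV: "open (U \<inter> V)"
      using triv_domain[OF t(1)] V by blast
    \<comment> \<open>In this trivialisation the components of a tangent vector are its values on
      the coordinates, so the matrix entries of the anchor are exactly the functions in
      \<open>m\<close>.\<close>
    have "(V, n, \<lambda>p v i. if i < n then v (\<lambda>q. \<psi> q i) else 0) \<in> tangent_triv n \<A>"
      unfolding tangent_triv_def using c by force
    with \<rho> t(1) i have m: "(\<lambda>q. \<rho> q (frame E \<Phi> a q) (\<lambda>q. \<psi> q i)) \<in> smooth_funs n \<A> (U \<inter> V)"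
      if "a < r" for a
      using that unfolding smooth_bundle_map_def by fastforce
    have "(\<lambda>q. \<Phi> q (s q) a) \<in> smooth_funs n \<A> (U \<inter> V)" if "a < r" for a
      by (rule smooth_funs_subset[OF smooth_section_component[OF s t(1) that]]) blast
    then have "(\<lambda>q. \<Sum>a<r. \<Phi> q (s q) a * \<rho> q (frame E \<Phi> a q) (\<lambda>q. \<psi> q i)) \<in> smooth_funs n \<A> (U \<inter> V)"
      using m by (intro smooth_funs_sum smooth_funs_mult UV) auto
    then have "(\<lambda>q. \<rho> q (s q) (\<lambda>q. \<psi> q i)) \<in> smooth_funs n \<A> (U \<inter> V)"
    proof (rule smooth_funs_cong[OF UV])
      fix q assume "q \<in> U \<inter> V"
      then have "\<rho> q (s q) = (\<Sum>a<r. \<Phi> q (s q) a *\<^sub>R \<rho> q (frame E \<Phi> a q))"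
        by (intro linear_on_fibre_expansion[OF t(1)] lin smooth_section_in_fibre s) simp
      then show "(\<Sum>a<r. \<Phi> q (s q) a * \<rho> q (frame E \<Phi> a q) (\<lambda>q. \<psi> q i)) = \<rho> q (s q) (\<lambda>q. \<psi> q i)"
        by (simp add: sum_fun_apply)
    qed
    then show "\<exists>T. open T \<and> p \<in> T \<and> (\<lambda>q. \<rho> q (s q) (\<lambda>q. \<psi> q i)) \<in> smooth_funs n \<A> T"
      using UV p t(2) by blast
  qed
  have W: "openin (Euclidean_space n) (\<psi> ` (UNIV \<inter> V))"
    by (rule chart_image_open[OF c open_UNIV])
  have F: "C_infinity_on n (\<psi> ` (UNIV \<inter> V)) F"
    unfolding F_def by (rule smooth_funsD[OF f c])
  have "C_infinity_on n (\<psi> ` V)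
      (\<lambda>x. \<rho> (inv_into V \<psi> x) (s (inv_into V \<psi> x)) (\<lambda>q. \<psi> q i))" if "i < n" for i
    using smooth_funsD[OF X[OF that] c] by simp
  then have "C_infinity_on n (\<psi> ` (UNIV \<inter> V))
      (\<lambda>x. \<Sum>i<n. \<rho> (inv_into V \<psi> x) (s (inv_into V \<psi> x)) (\<lambda>q. \<psi> q i) * partial_deriv i F x)"
    using C_infinity_on_partial[OF F] W
    by (intro C_infinity_on_sum C_infinity_on_mult) simp_all
  then show "C_infinity_on n (\<psi> ` (UNIV \<inter> V)) (\<lambda>x. anchor_act \<rho> s f (inv_into V \<psi> x))"
  proof (rule C_infinity_on_cong[OF W])
    fix x assume "x \<in> \<psi> ` (UNIV \<inter> V)"
    then obtain q where q: "q \<in> V" "x = \<psi> q" by blast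
    show "(\<Sum>i<n. \<rho> (inv_into V \<psi> x) (s (inv_into V \<psi> x)) (\<lambda>q. \<psi> q i) * partial_deriv i F x)
        = anchor_act \<rho> s f (inv_into V \<psi> x)"
      using tangent_vector_in_chart[OF tan[OF smooth_section_in_fibre[OF s]] c q(1)
          C_infinity_smooth_near[OF f]] q
      by (simp add: chart_inv[OF c] anchor_act_def vf_apply_def anchor_field_def F_def)
  qed
qed

end


section \<open>Formal exponentials of derivations\<close>

text \<open>The coefficient of \<open>t ^ n\<close> in the exponential of \<open>t\<close> times
  \<open>a\<close>. With this normalisation the Leibniz rule carries no binomial
  coefficients.\<close>

definition divided_power :: "('a::real_vector \<Rightarrow> 'a) \<Rightarrow> nat \<Rightarrow> 'a \<Rightarrow> 'a"
  where "divided_power a n x = (1 / fact n) *\<^sub>R (a ^^ n) x"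

text \<open>Relative to \<open>S\<close>, because the bracket and the anchor action are controlled
  only on smooth sections and smooth functions.\<close>

definition endo_on :: "'a::real_vector set \<Rightarrow> ('a \<Rightarrow> 'a) \<Rightarrow> bool"
  where "endo_on S a \<longleftrightarrow> linear_on_subspace S a \<and> (\<forall>x\<in>S. a x \<in> S)"

lemma endo_on_funpow_closed: "\<lbrakk>endo_on S a; x \<in> S\<rbrakk> \<Longrightarrow> (a ^^ n) x \<in> S"
  by (induction n) (auto simp: endo_on_def)

lemma endo_on_funpow_zero:
  "\<lbrakk>subspace S; endo_on S a\<rbrakk> \<Longrightarrow> (a ^^ n) 0 = 0"
  by (induction n) (simp_all add: endo_on_def linear_on_subspace_zero)

lemma divided_power_0 [simp]: "divided_power a 0 x = x"
  by (simp add: divided_power_def)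

lemma divided_power_closed:
  "\<lbrakk>subspace S; endo_on S a; x \<in> S\<rbrakk> \<Longrightarrow> divided_power a n x \<in> S"
  by (simp add: divided_power_def subspace_scale endo_on_funpow_closed)

lemma divided_power_of_zero:
  "\<lbrakk>subspace S; endo_on S a\<rbrakk> \<Longrightarrow> divided_power a n 0 = 0"
  by (simp add: divided_power_def endo_on_funpow_zero)

lemma divided_power_Suc:
  assumes "endo_on S a" "x \<in> S"
  shows "real (Suc n) *\<^sub>R divided_power a (Suc n) x = a (divided_power a n x)"
proof -
  have "a (divided_power a n x) = (1 / fact n) *\<^sub>R a ((a ^^ n) x)"
    unfolding divided_power_def
    using assms(1) endo_on_funpow_closed[OF assms]
    by (intro linear_on_subspace_scaleR[of S]) (simp_all add: endo_on_def)
  then show ?thesis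
    by (simp add: divided_power_def field_simps del: of_nat_Suc)
qed

lemma divided_power_scaleR:
  assumes "endo_on S a" "x \<in> S"
  shows "divided_power a n (c *\<^sub>R x) = c *\<^sub>R divided_power a n x"
proof -
  have "(a ^^ n) (c *\<^sub>R x) = c *\<^sub>R (a ^^ n) x"
  proof (induction n)
    case (Suc n)
    then show ?case
      using linear_on_subspace_scaleR[of S a "(a ^^ n) x" c] assms(1) endo_on_funpow_closed[OF assms]
      by (simp add: endo_on_def)
  qed simp
  then show ?thesis by (simp add: divided_power_def)
qed

text \<open>Covers the bracket, the anchor action, the multiplication of sections by functions and
  the inner product alike.\<close>

locale bilinear_on =
  fixes S :: "'a::real_vector set" and T :: "'b::real_vector set" and R :: "'c::real_vector set"
    and b :: "'a \<Rightarrow> 'b \<Rightarrow> 'c"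
  assumes subspaces: "subspace S" "subspace T" "subspace R"
    and closed: "\<lbrakk>x \<in> S; y \<in> T\<rbrakk> \<Longrightarrow> b x y \<in> R"
    and linear_left: "y \<in> T \<Longrightarrow> linear_on_subspace S (\<lambda>x. b x y)"
    and linear_right: "x \<in> S \<Longrightarrow> linear_on_subspace T (b x)"
begin

lemma zero_left: "y \<in> T \<Longrightarrow> b 0 y = 0"
  using linear_on_subspace_zero[OF subspaces(1) linear_left] .

lemma zero_right: "x \<in> S \<Longrightarrow> b x 0 = 0"
  using linear_on_subspace_zero[OF subspaces(2) linear_right] .

lemma extend2_closed:
  assumes "X \<in> series2_over S" "Y \<in> series2_over T"
  shows "extend2 b X Y \<in> series2_over R"
  using assms by (auto simp: series2_over_def extend2_def intro!: subspace_sum subspaces closed)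

text \<open>Multiplication by a monomial shifts indices. Coefficients below the shift need the
  explicit 0, since \<open>i - p\<close> and \<open>j - q\<close> are truncated there.\<close>

lemma extend2_monomial_left:
  assumes Y: "Y \<in> series2_over T"
  shows "extend2 b (monomial2 p q x) Y
    = (\<lambda>i j. if p \<le> i \<and> q \<le> j then b x (Y (i - p) (j - q)) else 0)"
proof (intro ext)
  fix i j
  have "b (monomial2 p q x k l) (Y (i - k) (j - l))
      = (if l = q then if k = p then b x (Y (i - k) (j - l)) else 0 else 0)" for k l
    using Y zero_left by (auto simp: monomial2_def series2_over_def)
  then have "extend2 b (monomial2 p q x) Y i j
      = (\<Sum>k\<le>i. \<Sum>l\<le>j. if l = q then if k = p then b x (Y (i - k) (j - l)) else 0 else 0)"
    by (simp add: extend2_def)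
  also have "\<dots> = (\<Sum>k\<le>i. if k = p then if q \<le> j then b x (Y (i - k) (j - q)) else 0 else 0)"
    by (rule sum.cong) auto
  also have "\<dots> = (if p \<le> i \<and> q \<le> j then b x (Y (i - p) (j - q)) else 0)"
    by simp
  finally show "extend2 b (monomial2 p q x) Y i j
      = (if p \<le> i \<and> q \<le> j then b x (Y (i - p) (j - q)) else 0)" .
qed

text \<open>Induction along the recursion of divided powers. Applying \<open>a''\<close> to the sum
  for \<open>n\<close> produces each \<open>t k\<close> with weight \<open>k\<close> from the left
  factor and \<open>Suc n - k\<close> from the right one; the total \<open>Suc n\<close>
  cancels.\<close>

lemma divided_power_Leibniz:
  assumes a: "endo_on S a" "endo_on T a'" "endo_on R a''"
    and der: "\<And>x y. \<lbrakk>x \<in> S; y \<in> T\<rbrakk> \<Longrightarrow> a'' (b x y) = b (a x) y + b x (a' y)"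
    and x: "x \<in> S" and y: "y \<in> T"
  shows "divided_power a'' n (b x y)
    = (\<Sum>k\<le>n. b (divided_power a k x) (divided_power a' (n - k) y))"
proof (induction n)
  case 0
  then show ?case by simp
next
  case (Suc n)
  define d where "d k = divided_power a k x" for k
  define e where "e k = divided_power a' k y" for k
  define t where "t k = b (d k) (e (Suc n - k))" for k
  have d: "d k \<in> S" and e: "e k \<in> T" for k
    by (simp_all add: d_def e_def divided_power_closed[OF subspaces(1) a(1) x]
        divided_power_closed[OF subspaces(2) a(2) y])
  have ad: "a (d k) = real (Suc k) *\<^sub>R d (Suc k)" and ae: "a' (e k) = real (Suc k) *\<^sub>R e (Suc k)" for k
    unfolding d_def e_def by (simp_all only: divided_power_Suc[OF a(1) x] divided_power_Suc[OF a(2) y])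
  have "real (Suc n) *\<^sub>R divided_power a'' (Suc n) (b x y) = a'' (\<Sum>k\<le>n. b (d k) (e (n - k)))"
    unfolding divided_power_Suc[OF a(3) closed[OF x y]] Suc d_def e_def ..
  also have "\<dots> = (\<Sum>k\<le>n. a'' (b (d k) (e (n - k))))"
    using a(3) by (intro linear_on_subspace_sum[OF subspaces(3)] closed d e) (simp add: endo_on_def)
  also have "\<dots> = (\<Sum>k\<le>n. real (Suc k) *\<^sub>R t (Suc k) + real (Suc n - k) *\<^sub>R t k)"
  proof (rule sum.cong)
    fix k assume "k \<in> {..n}"
    then have k: "Suc (n - k) = Suc n - k" by auto
    show "a'' (b (d k) (e (n - k))) = real (Suc k) *\<^sub>R t (Suc k) + real (Suc n - k) *\<^sub>R t k"
      using linear_on_subspace_scaleR[OF linear_left[OF e] d]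
        linear_on_subspace_scaleR[OF linear_right[OF d] e]
      by (simp only: der[OF d e] ad ae k t_def diff_Suc_Suc)
  qed simp
  also have "\<dots> = (\<Sum>k\<le>n. real (Suc k) *\<^sub>R t (Suc k)) + (\<Sum>k\<le>n. real (Suc n - k) *\<^sub>R t k)"
    by (rule sum.distrib)
  \<comment> \<open>The shifted sum may start at 0, since the new term has weight 0; likewise the
    top term added to the other sum next.\<close>
  also have "(\<Sum>k\<le>n. real (Suc k) *\<^sub>R t (Suc k)) = (\<Sum>k\<le>Suc n. real k *\<^sub>R t k)"
    by (simp only: sum.atMost_Suc_shift[of "\<lambda>k. real k *\<^sub>R t k"]) simp
  also have "(\<Sum>k\<le>n. real (Suc n - k) *\<^sub>R t k) = (\<Sum>k\<le>Suc n. real (Suc n - k) *\<^sub>R t k)"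
    by simp
  also have "(\<Sum>k\<le>Suc n. real k *\<^sub>R t k) + (\<Sum>k\<le>Suc n. real (Suc n - k) *\<^sub>R t k)
      = real (Suc n) *\<^sub>R (\<Sum>k\<le>Suc n. t k)"
    unfolding sum.distrib[symmetric] scaleR_sum_right
    by (rule sum.cong) (simp_all only: scaleR_left_distrib[symmetric] of_nat_add[symmetric]
        atMost_iff le_add_diff_inverse)
  finally have "real (Suc n) *\<^sub>R divided_power a'' (Suc n) (b x y) = real (Suc n) *\<^sub>R (\<Sum>k\<le>Suc n. t k)" .
  then show ?case
    unfolding t_def d_def e_def by (simp del: of_nat_Suc sum.atMost_Suc)
qed

end

section \<open>Exponentials of series in two parameters\<close>

lemma monomial2_over: "\<lbrakk>subspace S; x \<in> S\<rbrakk> \<Longrightarrow> monomial2 p q x \<in> series2_over S"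
  by (simp add: series2_over_def monomial2_def subspace_0)

text \<open>In the exponentials evaluated below, the powers are homogeneous in one parameter, so at
  most one term reaches each coefficient. The formula includes the case that this term is 0 too and
  the index set is empty.\<close>

lemma formal_exp_eq_term:
  assumes "\<And>m. m \<noteq> d \<Longrightarrow> (A ^^ m) Y i j = 0"
  shows "formal_exp A Y i j = (1 / fact d) *\<^sub>R (A ^^ d) Y i j"
proof -
  have "formal_exp A Y i j = (\<Sum>m\<in>{d}. (1 / fact m) *\<^sub>R (A ^^ m) Y i j)"
    unfolding formal_exp_def by (rule sum.mono_neutral_left) (use assms in auto)
  then show ?thesis by simp
qed

text \<open>Values in the second space let the operators \<open>b x\<close> be iterated, hence
  exponentiated.\<close>

locale action_on = bilinear_on S T T b
  for S :: "'a::real_vector set" and T :: "'b::real_vector set" and b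
begin

lemma endo: "x \<in> S \<Longrightarrow> endo_on T (b x)"
  by (simp add: endo_on_def linear_right closed)

lemma extend2_power_closed:
  assumes "X \<in> series2_over S" "Y \<in> series2_over T"
  shows "(extend2 b X ^^ m) Y \<in> series2_over T"
  by (induction m) (simp_all add: assms extend2_closed)

lemma formal_exp_closed:
  assumes "X \<in> series2_over S" "Y \<in> series2_over T"
  shows "formal_exp (extend2 b X) Y \<in> series2_over T"
  using extend2_power_closed[OF assms]
  by (auto simp: series2_over_def formal_exp_def intro!: subspace_sum subspace_scale subspaces)

text \<open>The \<open>m\<close>-th power carries the factor \<open>t\<^sub>1 ^ m\<close>, and
  \<open>Z\<close> is free of \<open>t\<^sub>1\<close>, so only \<open>m = i\<close> contributes.
  \<open>Z\<close> may depend on \<open>t\<^sub>2\<close>, because it will be an exponential in that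
  parameter.\<close>

lemma formal_exp_t1:
  assumes e: "e \<in> S" and Z: "Z \<in> series2_over T" and free: "\<And>i j. i \<noteq> 0 \<Longrightarrow> Z i j = 0"
  shows "formal_exp (extend2 b (times_t1 e)) Z = (\<lambda>i j. divided_power (b e) i (Z 0 j))"
proof (intro ext)
  fix i j
  have "(extend2 b (times_t1 e) ^^ m) Z = (\<lambda>i j. if i = m then (b e ^^ m) (Z 0 j) else 0)" for m
  proof (induction m)
    case 0
    then show ?case by (auto simp: fun_eq_iff free)
  next
    case (Suc m)
    then show ?case
      using extend2_monomial_left[OF extend2_power_closed[OF monomial2_over[OF subspaces(1) e] Z], of 1 0 e]
      by (auto simp: fun_eq_iff zero_right[OF e])
  qed
  then show "formal_exp (extend2 b (times_t1 e)) Z i j = divided_power (b e) i (Z 0 j)"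
    by (subst formal_exp_eq_term[of i]) (auto simp: divided_power_def)
qed

text \<open>Used for \<open>q = 0\<close>, where the monomial is a constant, and for
  \<open>q = 1\<close>, where it is \<open>times_t2\<close>.\<close>

lemma formal_exp_t1_monomial:
  assumes e: "e \<in> S" and y: "y \<in> T"
  shows "formal_exp (extend2 b (times_t1 e)) (monomial2 0 q y)
    = (\<lambda>i j. if j = q then divided_power (b e) i y else 0)"
  by (subst formal_exp_t1[OF e monomial2_over[OF subspaces(2) y]])
    (auto simp: monomial2_def fun_eq_iff divided_power_of_zero[OF subspaces(2) endo[OF e]])

lemma formal_exp_t2_const:
  assumes e: "e \<in> S" and y: "y \<in> T"
  shows "formal_exp (extend2 b (times_t2 e)) (const2 y)
    = (\<lambda>i j. if i = 0 then divided_power (b e) j y else 0)"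
proof (intro ext)
  fix i j
  have "(extend2 b (times_t2 e) ^^ m) (const2 y) = monomial2 0 m ((b e ^^ m) y)" for m
  proof (induction m)
    case (Suc m)
    have "monomial2 0 m ((b e ^^ m) y) \<in> series2_over T"
      by (intro monomial2_over subspaces endo_on_funpow_closed[OF endo[OF e] y])
    note left = extend2_monomial_left[OF this, of 0 1 e]
    have "(extend2 b (times_t2 e) ^^ Suc m) (const2 y)
        = extend2 b (times_t2 e) (monomial2 0 m ((b e ^^ m) y))"
      by (simp only: funpow.simps o_apply Suc)
    also have "\<dots> = monomial2 0 (Suc m) ((b e ^^ Suc m) y)"
      unfolding left by (auto simp: fun_eq_iff monomial2_def zero_right[OF e])
    finally show ?case .
  qed simp
  then show "formal_exp (extend2 b (times_t2 e)) (const2 y) i j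
      = (if i = 0 then divided_power (b e) j y else 0)"
    by (subst formal_exp_eq_term[of j]) (auto simp: divided_power_def monomial2_def)
qed

end

text \<open>Serves the identities for multiples of sections and for inner products. The coefficients
  with \<open>j = 0\<close> are the Leibniz rule; the others vanish on both sides.\<close>

lemma formal_exp_t1_product:
  assumes b: "bilinear_on P Q R b"
    and c: "action_on S P c" "action_on S Q c'" "action_on S R c''"
    and der: "\<And>x y. \<lbrakk>x \<in> P; y \<in> Q\<rbrakk> \<Longrightarrow> c'' e (b x y) = b (c e x) y + b x (c' e y)"
    and e: "e \<in> S" and x: "x \<in> P" and y: "y \<in> Q"
  shows "formal_exp (extend2 c'' (times_t1 e)) (const2 (b x y)) =
    extend2 b (formal_exp (extend2 c (times_t1 e)) (const2 x))
      (formal_exp (extend2 c' (times_t1 e)) (const2 y))"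
proof -
  interpret b: bilinear_on P Q R b by (rule b)
  interpret c: action_on S P c by (rule c)
  interpret c': action_on S Q c' by (rule c)
  interpret c'': action_on S R c'' by (rule c)
  have cl: "divided_power (c e) k x \<in> P" "divided_power (c' e) k y \<in> Q" for k
    by (intro divided_power_closed b.subspaces c.endo c'.endo e x y)+
  have "(if j = 0 then divided_power (c'' e) i (b x y) else 0) =
      (\<Sum>k\<le>i. \<Sum>l\<le>j. b (if l = 0 then divided_power (c e) k x else 0)
        (if j - l = 0 then divided_power (c' e) (i - k) y else 0))" for i j :: nat
  proof (cases "j = 0")
    case True
    then show ?thesis
      using b.divided_power_Leibniz[OF c.endo[OF e] c'.endo[OF e] c''.endo[OF e] der x y] by simp
  next
    case False
    \<comment> \<open>For \<open>j\<close> nonzero, \<open>l\<close> and \<open>j - l\<close> cannot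
      both be 0, so one argument of \<open>b\<close> is 0.\<close>
    then have "b (if l = 0 then divided_power (c e) k x else 0)
        (if j - l = 0 then divided_power (c' e) (i - k) y else 0) = 0" for k l
      by (auto simp: b.zero_left b.zero_right cl b.subspaces(2) subspace_0)
    with False show ?thesis by (simp only: if_False sum.neutral_const)
  qed
  then show ?thesis
    unfolding c.formal_exp_t1_monomial[OF e x] c'.formal_exp_t1_monomial[OF e y]
      c''.formal_exp_t1_monomial[OF e b.closed[OF x y]]
    by (intro ext) (simp only: extend2_def)
qed

text \<open>Serves the identities for sections, where \<open>der\<close> is the Jacobi identity, and
  for functions, where it says that the anchor respects brackets.\<close>

lemma formal_exp_self_distributive:
  assumes c: "action_on S S c" and b: "action_on S T b"
    and der: "\<And>x y. \<lbrakk>x \<in> S; y \<in> T\<rbrakk> \<Longrightarrow> b e1 (b x y) = b (c e1 x) y + b x (b e1 y)"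
    and e1: "e1 \<in> S" and e2: "e2 \<in> S" and y: "y \<in> T"
  shows "formal_exp (extend2 b (times_t1 e1)) (formal_exp (extend2 b (times_t2 e2)) (const2 y)) =
    formal_exp (extend2 b (formal_exp (extend2 c (times_t1 e1)) (times_t2 e2)))
      (formal_exp (extend2 b (times_t1 e1)) (const2 y))"
proof (intro ext)
  fix i j
  interpret c: action_on S S c by (rule c)
  interpret b: action_on S T b by (rule b)
  define d where "d = divided_power (b e1)"
  have d: "d k z \<in> T" if "z \<in> T" for k z
    unfolding d_def by (intro divided_power_closed b.subspaces b.endo e1 that)
  have dc: "divided_power (c e1) k e2 \<in> S" for k
    by (intro divided_power_closed c.subspaces c.endo e1 e2)
  have e2y: "(b e2 ^^ m) y \<in> T" for m
    by (rule endo_on_funpow_closed[OF b.endo[OF e2] y])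
  have t2: "monomial2 0 0 y \<in> series2_over T"
    by (rule monomial2_over[OF b.subspaces(2) y])
  define X where "X = formal_exp (extend2 c (times_t1 e1)) (times_t2 e2)"
  define Y where "Y = formal_exp (extend2 b (times_t1 e1)) (const2 y)"
  have X: "X = (\<lambda>i j. if j = 1 then divided_power (c e1) i e2 else 0)"
    unfolding X_def by (rule c.formal_exp_t1_monomial[OF e1 e2])
  have Y: "Y = (\<lambda>i j. if j = 0 then d i y else 0)"
    unfolding Y_def d_def by (rule b.formal_exp_t1_monomial[OF e1 y])
  \<comment> \<open>\<open>X\<close> has degree 1 and \<open>Y\<close> degree 0 in \<open>t\<^sub>2\<close>, so each coefficient of \<open>X\<^sup>m \<cdot> Y\<close> is one Leibniz sum.\<close>
  have pow: "(extend2 b X ^^ m) Y = (\<lambda>i j. if j = m then d i ((b e2 ^^ m) y) else 0)" for m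
  proof (induction m)
    case 0
    then show ?case by (auto simp: Y fun_eq_iff)
  next
    case (Suc m)
    show ?case
    proof (intro ext)
      fix i j
      define t where "t k = b (divided_power (c e1) k e2) (d (i - k) ((b e2 ^^ m) y))" for k
      have "b (X k l) (if j - l = m then d (i - k) ((b e2 ^^ m) y) else 0)
          = (if l = 1 then if j - 1 = m then t k else 0 else 0)" for k l
        by (auto simp: X t_def b.zero_left b.zero_right dc d e2y subspace_0 b.subspaces)
      then have "(extend2 b X ^^ Suc m) Y i j
          = (\<Sum>k\<le>i. \<Sum>l\<le>j. if l = 1 then if j - 1 = m then t k else 0 else 0)"
        by (simp only: funpow.simps o_apply Suc extend2_def)
      \<comment> \<open>For \<open>j = 0\<close> the index \<open>l = 1\<close> is out of range, so
        the truncated \<open>j - 1\<close> cannot produce a spurious term with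
        \<open>m = 0\<close>.\<close>
      also have "\<dots> = (\<Sum>k\<le>i. if j = Suc m then t k else 0)"
        by (rule sum.cong) (cases j; simp del: sum.atMost_Suc)+
      also have "\<dots> = (if j = Suc m then \<Sum>k\<le>i. t k else 0)"
        by simp
      also have "(\<Sum>k\<le>i. t k) = d i (b e2 ((b e2 ^^ m) y))"
        unfolding t_def d_def
        by (rule b.divided_power_Leibniz[OF c.endo[OF e1] b.endo[OF e1] b.endo[OF e1] der e2 e2y, symmetric])
      finally show "(extend2 b X ^^ Suc m) Y i j = (if j = Suc m then d i ((b e2 ^^ Suc m) y) else 0)"
        by simp
    qed
  qed
  \<comment> \<open>Each application of \<open>extend2 b X\<close> raises the degree in
    \<open>t\<^sub>2\<close> by exactly one, so only the \<open>j\<close>-th power meets this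
    coefficient.\<close>
  have "formal_exp (extend2 b X) Y i j = (1 / fact j) *\<^sub>R d i ((b e2 ^^ j) y)"
    by (subst formal_exp_eq_term[of j]) (simp_all add: pow)
  \<comment> \<open>The factor \<open>1 / fact j\<close> moves inside by linearity of
    \<open>d i\<close>.\<close>
  also have "\<dots> = d i (divided_power (b e2) j y)"
    unfolding d_def divided_power_def[of "b e2"]
    by (rule divided_power_scaleR[OF b.endo[OF e1] e2y, symmetric])
  also have "\<dots> = formal_exp (extend2 b (times_t1 e1)) (formal_exp (extend2 b (times_t2 e2)) (const2 y)) i j"
    by (subst b.formal_exp_t1[OF e1 b.formal_exp_closed[OF monomial2_over[OF b.subspaces(1) e2] t2]])
      (simp_all only: b.formal_exp_t2_const[OF e2 y] d_def if_False if_True simp_thms)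
  finally show "formal_exp (extend2 b (times_t1 e1)) (formal_exp (extend2 b (times_t2 e2)) (const2 y)) i j
      = formal_exp (extend2 b X) Y i j"
    by simp
qed


section \<open>Courant algebroids\<close>

context courant_algebroid
begin

lemma anchor_in_tangent_space: "u \<in> E p \<Longrightarrow> \<rho> p u \<in> tangent_space n \<A> p"
  using anchor by (auto simp: smooth_bundle_map_def)

lemma anchor_linear: "linear_on_subspace (E p) (\<rho> p)"
  using anchor by (simp add: smooth_bundle_map_def)

lemma action_bracket: "action_on (smooth_sections n \<A> E \<T>) (smooth_sections n \<A> E \<T>) br"
  unfolding action_on_def
  by unfold_locales
    (simp_all add: subspace_smooth_sections bracket_closed bracket_linear_left bracket_linear_right)

text \<open>Linearity in the section is that of \<open>\<rho>\<close> on fibres, linearity in the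
  function is that of tangent vectors, and closure is the smoothness of anchor actions.\<close>

lemma action_anchor: "action_on (smooth_sections n \<A> E \<T>) (C_infinity n \<A>) (anchor_act \<rho>)"
  unfolding action_on_def
proof
  show "linear_on_subspace (smooth_sections n \<A> E \<T>) (\<lambda>s. anchor_act \<rho> s f)" for f
    using linear_on_subspace_add[OF anchor_linear] linear_on_subspace_scaleR[OF anchor_linear]
    by (auto simp: linear_on_subspace_def[of "smooth_sections n \<A> E \<T>"] anchor_act_def vf_apply_def
        anchor_field_def fun_eq_iff smooth_section_in_fibre)
  show "linear_on_subspace (C_infinity n \<A>) (anchor_act \<rho> s)"
    if "s \<in> smooth_sections n \<A> E \<T>" for s
  proof -
    note tan = anchor_in_tangent_space[OF smooth_section_in_fibre[OF that]]
    show ?thesis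
      using tangent_add[OF tan] tangent_scaleR[OF tan] C_infinity_smooth_near
      by (simp add: linear_on_subspace_def anchor_act_def vf_apply_def
          anchor_field_def fun_eq_iff func_plus)
  qed
qed (simp_all add: subspace_smooth_sections subspace_C_infinity anchor_act_closed[OF anchor])

lemma bilinear_section_mult:
  "bilinear_on (C_infinity n \<A>) (smooth_sections n \<A> E \<T>) (smooth_sections n \<A> E \<T>) section_mult"
  by standard
    (simp_all add: subspace_smooth_sections subspace_C_infinity section_mult_closed,
     simp_all add: linear_on_subspace_def section_mult_def fun_eq_iff algebra_simps)

lemma bilinear_section_inner:
  "bilinear_on (smooth_sections n \<A> E \<T>) (smooth_sections n \<A> E \<T>) (C_infinity n \<A>) (section_inner g)"
proof
  have lin: "linear_on_subspace (E p) (g p u)" and sym: "\<lbrakk>u \<in> E p; w \<in> E p\<rbrakk> \<Longrightarrow> g p u w = g p w u"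
    if "u \<in> E p" for p u w
    using metric that by (simp_all add: pseudo_euclidean_metric_def)
  show right: "linear_on_subspace (smooth_sections n \<A> E \<T>) (section_inner g s)"
    if "s \<in> smooth_sections n \<A> E \<T>" for s
    using smooth_section_in_fibre that lin
    by (auto simp: linear_on_subspace_def section_inner_def fun_eq_iff)
  show "linear_on_subspace (smooth_sections n \<A> E \<T>) (\<lambda>s. section_inner g s t)"
    if t: "t \<in> smooth_sections n \<A> E \<T>" for t
  proof -
    have "section_inner g s t = section_inner g t s" if "s \<in> smooth_sections n \<A> E \<T>" for s
      using sym smooth_section_in_fibre t that by (simp add: section_inner_def fun_eq_iff)
    then show ?thesis
      using right[OF t] subspace_smooth_sections
      by (simp add: linear_on_subspace_def subspace_add subspace_scale)
  qed
qed (simp_all add: subspace_smooth_sections subspace_C_infinity section_inner_closed[OF metric])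

text \<open>The anchor turns brackets into commutators of vector fields. \<open>f\<close> is smooth
  near every point, so the default value 0 of \<open>lie_bracket\<close> does not occur.\<close>

lemma anchor_act_bracket:
  assumes e: "e1 \<in> smooth_sections n \<A> E \<T>" "e2 \<in> smooth_sections n \<A> E \<T>"
    and f: "f \<in> C_infinity n \<A>"
  shows "anchor_act \<rho> e1 (anchor_act \<rho> e2 f)
    = anchor_act \<rho> (br e1 e2) f + anchor_act \<rho> e2 (anchor_act \<rho> e1 f)"
  using C_infinity_smooth_near[OF f]
  by (simp add: anchor_act_def anchor_bracket[OF e] lie_bracket_def fun_eq_iff)
    (simp add: vf_apply_def)

lemma formal_metric_bundle_rackoid:
  "formal_metric_bundle_rackoid n \<A> E \<T> g (exp_ad br) (exp_anchor \<rho>)"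
  unfolding formal_metric_bundle_rackoid_def formal_bundle_rackoid_def exp_ad_def exp_anchor_def
proof (intro conjI ballI impI)
  show "smooth_vector_bundle n \<A> E \<T>"
    by unfold_locales
  show "pseudo_euclidean_metric n \<A> E \<T> g"
    by (rule metric)
next
  fix X Y assume "X \<in> series2_over (smooth_sections n \<A> E \<T>)" "Y \<in> series2_over (smooth_sections n \<A> E \<T>)"
  then show "formal_exp (extend2 br X) Y \<in> series2_over (smooth_sections n \<A> E \<T>)"
    by (rule action_on.formal_exp_closed[OF action_bracket])
next
  fix X F assume "X \<in> series2_over (smooth_sections n \<A> E \<T>)" "F \<in> series2_over (C_infinity n \<A>)"
  then show "formal_exp (extend2 (anchor_act \<rho>) X) F \<in> series2_over (C_infinity n \<A>)"
    by (rule action_on.formal_exp_closed[OF action_anchor])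
next
  fix e1 e2 e3 assume e: "e1 \<in> smooth_sections n \<A> E \<T>" "e2 \<in> smooth_sections n \<A> E \<T>"
    "e3 \<in> smooth_sections n \<A> E \<T>"
  then show "formal_exp (extend2 br (times_t1 e1)) (formal_exp (extend2 br (times_t2 e2)) (const2 e3)) =
      formal_exp (extend2 br (formal_exp (extend2 br (times_t1 e1)) (times_t2 e2)))
        (formal_exp (extend2 br (times_t1 e1)) (const2 e3))"
    by (intro formal_exp_self_distributive[OF action_bracket action_bracket]) (auto intro: jacobi)
  show "formal_exp (extend2 (anchor_act \<rho>) (times_t1 e1)) (const2 (section_inner g e2 e3)) =
      extend2 (section_inner g) (formal_exp (extend2 br (times_t1 e1)) (const2 e2))
        (formal_exp (extend2 br (times_t1 e1)) (const2 e3))"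
    using e by (intro formal_exp_t1_product[OF bilinear_section_inner action_bracket action_bracket
          action_anchor]) (auto intro: metric_invariant)
next
  fix e1 e2 f assume e: "e1 \<in> smooth_sections n \<A> E \<T>" "e2 \<in> smooth_sections n \<A> E \<T>"
    and f: "f \<in> C_infinity n \<A>"
  then show "formal_exp (extend2 (anchor_act \<rho>) (times_t1 e1))
        (formal_exp (extend2 (anchor_act \<rho>) (times_t2 e2)) (const2 f)) =
      formal_exp (extend2 (anchor_act \<rho>) (formal_exp (extend2 br (times_t1 e1)) (times_t2 e2)))
        (formal_exp (extend2 (anchor_act \<rho>) (times_t1 e1)) (const2 f))"
    by (intro formal_exp_self_distributive[OF action_bracket action_anchor]) (auto intro: anchor_act_bracket)
  \<comment> \<open>The Leibniz axiom with its summands exchanged, now in the form of a derivation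
    property along the anchor action and the bracket.\<close>
  have "br e1 (section_mult h s) = section_mult (anchor_act \<rho> e1 h) s + section_mult h (br e1 s)"
    if "h \<in> C_infinity n \<A>" "s \<in> smooth_sections n \<A> E \<T>" for h s
    using leibniz[OF e(1) that(2,1)] by (simp add: add.commute)
  then show "formal_exp (extend2 br (times_t1 e1)) (const2 (section_mult f e2)) =
      extend2 section_mult (formal_exp (extend2 (anchor_act \<rho>) (times_t1 e1)) (const2 f))
        (formal_exp (extend2 br (times_t1 e1)) (const2 e2))"
    using e f by (intro formal_exp_t1_product[OF bilinear_section_mult action_anchor action_bracket
          action_bracket]) auto
qed

end

theorem mainTheorem2:
  fixes n :: nat
    and \<A> :: "'m::{t2_space, second_countable_topology} chart set"
    and E :: "'m \<Rightarrow> 'e::real_vector set" and \<T> :: "('m, 'e) triv set"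
    and br :: "('m \<Rightarrow> 'e) \<Rightarrow> ('m \<Rightarrow> 'e) \<Rightarrow> 'm \<Rightarrow> 'e"
    and \<rho> :: "'m \<Rightarrow> 'e \<Rightarrow> ('m \<Rightarrow> real) \<Rightarrow> real"
    and g :: "'m \<Rightarrow> 'e \<Rightarrow> 'e \<Rightarrow> real"
  assumes "courant_algebroid n \<A> E \<T> br \<rho> g"
  shows "formal_metric_bundle_rackoid n \<A> E \<T> g (exp_ad br) (exp_anchor \<rho>)"
  using assms by (rule courant_algebroid.formal_metric_bundle_rackoid)

end
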